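(* Let $\alpha>0$, let $w\in A^{\mathrm{restricted}}_{\infty}$, and let $\mu$ be a positive Borel measure on $\mathbb{C}$. Then there exists $\delta\in(0,1)$ such that the following conditions are equivalent: (a) $T_{\mu}$ is bounded on $F^2_{\alpha,w}$; (b) $\widetilde{\mu}$ is bounded on $\mathbb{C}$; (c) for some (or, equivalently, any) $r\in(0,\delta)$, $\widehat{\mu}_{w,r}$ is bounded on $\mathbb{C}$. Moreover, for $r\in(0,\delta)$, $$\|T_{\mu}\|_{F^2_{\alpha,w}\to F^2_{\alpha,w}}\asymp\sup_{z\in\mathbb{C}}\widetilde{\mu}(z)\asymp\sup_{z\in\mathbb{C}}\widehat{\mu}_{w,r}(z),$$ where the implicit constants are independent of $\mu$.
   Context: A weight is a non-negative locally integrable function $w$ on $\mathbb{C}$; $dA$ (and $A(\cdot)$) is Lebesgue measure on $\mathbb{C}$; $w(E):=\int_E w\,dA$; $D(z,r)$ is the disk with center $z$ and radius $r$. Squares $Q\subset\mathbb{C}$ have sides parallel to the axes, with side length $\ell(Q)$. For $1<p<\infty$ with $1/p+1/p'=1$, $w\in A_p^{\mathrm{restricted}}$ if for some (equivalently any) fixed $r>0$, $\sup_{\ell(Q)=r}\big(\frac1{A(Q)}\int_Q w\,dA\big)\big(\frac1{A(Q)}\int_Q w^{-p'/p}dA\big)^{p/p'}<\infty$; $w\in A_1^{\mathrm{restricted}}$ if for some (equivalently any) fixed $r>0$, $\sup_{\ell(Q)=r}\big(\frac1{A(Q)}\int_Q w\,dA\big)\|w^{-1}\|_{L^\infty(Q)}<\infty$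 (in particular both factors are finite, so $w>0$ a.e.). Set $A_\infty^{\mathrm{restricted}}:=\bigcup_{1\le p<\infty}A_p^{\mathrm{restricted}}$. $F^2_{\alpha,w}$ is the Hilbert space of entire functions $f$ with $\|f\|^2_{F^2_{\alpha,w}}=\int_{\mathbb{C}}|f(z)|^2e^{-\alpha|z|^2}w(z)\,dA(z)<\infty$, with inner product $\langle f,g\rangle_{F^2_{\alpha,w}}=\int_{\mathbb{C}}f\overline{g}\,e^{-\alpha|z|^2}w\,dA$. $B^w_z$ is its reproducing kernel at $z$ (so $f(z)=\langle f,B^w_z\rangle_{F^2_{\alpha,w}}$), and $b^w_z:=B^w_z/\|B^w_z\|_{F^2_{\alpha,w}}$. For a positive Borel measure $\mu$: the Toeplitz operator is $T_\mu f(z):=\int_{\mathbb{C}}f(\xi)\overline{B^w_z(\xi)}e^{-\alpha|\xi|^2}d\mu(\xi)$, $z\in\mathbb{C}$. "$T_\mu$ is bounded on $F^2_{\alpha,w}$" means that for every $f\in F^2_{\alpha,w}$ the integral converges absolutely for every $z$, and $T_\mu$ maps $F^2_{\alpha,w}$ boundedly into itself (the norm is $+\infty$ otherwise). The average function is $\widehat{\mu}_{w,r}(z):=\mu(D(z,r))/w(D(z,r))$; the Berezin transform is $\widetilde{\mu}(z):=\int_{\mathbb{C}}|b^w_z(\xi)|^2e^{-\alpha|\xi|^2}d\mu(\xi)$. $X\asymp Y$ means $c\,Y\le X\le C\,Y$ for constants $c,C>0$ (which may depend on $\alpha,w,r$). *)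

theory Defs
  imports
    "HOL-Complex_Analysis.Complex_Analysis"
    "HOL-Probability.Essential_Supremum"
begin

section \<open>Restricted Muckenhoupt weights on the complex plane\<close>

definition is_weight :: "(complex \<Rightarrow> real) \<Rightarrow> bool" where
  "is_weight w \<longleftrightarrow>
     (\<forall>z. 0 \<le> w z) \<and> (\<forall>K. compact K \<longrightarrow> set_integrable lebesgue K w)"

definition weight_mass :: "(complex \<Rightarrow> real) \<Rightarrow> complex set \<Rightarrow> ennreal" where
  "weight_mass w E = (\<integral>\<^sup>+z\<in>E. ennreal (w z) \<partial>lebesgue)"

text \<open>The closed square with sides parallel to the axes, lower left corner \<open>a\<close> and
  side length \<open>r\<close>.\<close>

definition square :: "complex \<Rightarrow> real \<Rightarrow> complex set" where
  "square a r = cbox a (a + Complex r r)"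

definition average :: "complex set \<Rightarrow> (complex \<Rightarrow> ennreal) \<Rightarrow> ennreal" where
  "average Q f = (\<integral>\<^sup>+z\<in>Q. f z \<partial>lebesgue) / emeasure lebesgue Q"

text \<open>The power \<open>x\<^sup>s\<close> of an extended nonnegative number, used only for \<open>s > 0\<close>; negative
  powers of a weight are powers of its reciprocal, where \<open>inverse 0 = \<infinity>\<close>.\<close>

definition ennreal_powr :: "ennreal \<Rightarrow> real \<Rightarrow> ennreal" where
  "ennreal_powr x s = (if x = \<infinity> then \<infinity> else ennreal (enn2real x powr s))"

definition conj_exponent :: "real \<Rightarrow> real" where
  "conj_exponent p = p / (p - 1)"

text \<open>In \<open>ennreal\<close> we have \<open>0 * \<infinity> = 0\<close>, so the finiteness of the second factor has to be
  required separately: otherwise a weight vanishing on a square would be admitted.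
  The first factor is finite by local integrability. The side length is existentially
  quantified, as the class does not depend on it.\<close>

definition A_p_restricted :: "real \<Rightarrow> (complex \<Rightarrow> real) set" where
  "A_p_restricted p = {w. is_weight w \<and> (\<exists>r>0.
     let p' = conj_exponent p;
         dual = (\<lambda>a. average (square a r) (\<lambda>z. ennreal_powr (inverse (ennreal (w z))) (p' / p)))
     in (\<forall>a. dual a < \<infinity>) \<and>
        (SUP a. average (square a r) (\<lambda>z. ennreal (w z)) * ennreal_powr (dual a) (p / p')) < \<infinity>)}"

definition A_1_restricted :: "(complex \<Rightarrow> real) set" where
  "A_1_restricted = {w. is_weight w \<and> (\<exists>r>0.
     let dual = (\<lambda>a. esssup (restrict_space lebesgue (square a r)) (\<lambda>z. inverse (ennreal (w z))))
     in (\<forall>a. dual a < \<infinity>) \<and>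
        (SUP a. average (square a r) (\<lambda>z. ennreal (w z)) * dual a) < \<infinity>)}"

definition A_infty_restricted :: "(complex \<Rightarrow> real) set" where
  "A_infty_restricted = A_1_restricted \<union> (\<Union>p\<in>{1<..}. A_p_restricted p)"


section \<open>Weighted Fock spaces\<close>

definition fock_space :: "real \<Rightarrow> (complex \<Rightarrow> real) \<Rightarrow> (complex \<Rightarrow> complex) set" where
  "fock_space \<alpha> w = {f. f holomorphic_on UNIV \<and>
     integrable lebesgue (\<lambda>z. (cmod (f z))\<^sup>2 * exp (- \<alpha> * (cmod z)\<^sup>2) * w z)}"

definition fock_norm :: "real \<Rightarrow> (complex \<Rightarrow> real) \<Rightarrow> (complex \<Rightarrow> complex) \<Rightarrow> real" where
  "fock_norm \<alpha> w f =
     sqrt (\<integral>z. (cmod (f z))\<^sup>2 * exp (- \<alpha> * (cmod z)\<^sup>2) * w z \<partial>lebesgue)"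

definition fock_inner ::
  "real \<Rightarrow> (complex \<Rightarrow> real) \<Rightarrow> (complex \<Rightarrow> complex) \<Rightarrow> (complex \<Rightarrow> complex) \<Rightarrow> complex" where
  "fock_inner \<alpha> w f g =
     (\<integral>z. f z * cnj (g z) * of_real (exp (- \<alpha> * (cmod z)\<^sup>2) * w z) \<partial>lebesgue)"

text \<open>\<open>rep_kernel \<alpha> w z\<close> is the function \<open>B\<^sub>z\<close>, so that \<open>rep_kernel \<alpha> w z \<xi> = B\<^sub>z(\<xi>)\<close>.\<close>

definition rep_kernel :: "real \<Rightarrow> (complex \<Rightarrow> real) \<Rightarrow> complex \<Rightarrow> complex \<Rightarrow> complex" where
  "rep_kernel \<alpha> w z =
     (THE g. g \<in> fock_space \<alpha> w \<and> (\<forall>f\<in>fock_space \<alpha> w. f z = fock_inner \<alpha> w f g))"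

definition normalized_kernel :: "real \<Rightarrow> (complex \<Rightarrow> real) \<Rightarrow> complex \<Rightarrow> complex \<Rightarrow> complex" where
  "normalized_kernel \<alpha> w z \<xi> =
     rep_kernel \<alpha> w z \<xi> / of_real (fock_norm \<alpha> w (rep_kernel \<alpha> w z))"


section \<open>Toeplitz operators, averages and Berezin transforms\<close>

definition positive_borel_measures :: "complex measure set" where
  "positive_borel_measures = {\<mu>. sets \<mu> = sets borel}"

definition toeplitz_integrand ::
  "real \<Rightarrow> (complex \<Rightarrow> real) \<Rightarrow> (complex \<Rightarrow> complex) \<Rightarrow> complex \<Rightarrow> complex \<Rightarrow> complex" where
  "toeplitz_integrand \<alpha> w f z \<xi> =
     f \<xi> * cnj (rep_kernel \<alpha> w z \<xi>) * of_real (exp (- \<alpha> * (cmod \<xi>)\<^sup>2))"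

definition toeplitz ::
  "real \<Rightarrow> (complex \<Rightarrow> real) \<Rightarrow> complex measure \<Rightarrow> (complex \<Rightarrow> complex) \<Rightarrow> complex \<Rightarrow> complex" where
  "toeplitz \<alpha> w \<mu> f z = (\<integral>\<xi>. toeplitz_integrand \<alpha> w f z \<xi> \<partial>\<mu>)"

definition toeplitz_bounded :: "real \<Rightarrow> (complex \<Rightarrow> real) \<Rightarrow> complex measure \<Rightarrow> bool" where
  "toeplitz_bounded \<alpha> w \<mu> \<longleftrightarrow>
     (\<forall>f\<in>fock_space \<alpha> w. (\<forall>z. integrable \<mu> (toeplitz_integrand \<alpha> w f z)) \<and>
        toeplitz \<alpha> w \<mu> f \<in> fock_space \<alpha> w) \<and>
     (\<exists>C. \<forall>f\<in>fock_space \<alpha> w. fock_norm \<alpha> w (toeplitz \<alpha> w \<mu> f) \<le> C * fock_norm \<alpha> w f)"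

definition toeplitz_norm :: "real \<Rightarrow> (complex \<Rightarrow> real) \<Rightarrow> complex measure \<Rightarrow> ennreal" where
  "toeplitz_norm \<alpha> w \<mu> =
     (if toeplitz_bounded \<alpha> w \<mu>
      then SUP f\<in>{f \<in> fock_space \<alpha> w. fock_norm \<alpha> w f \<le> 1}.
             ennreal (fock_norm \<alpha> w (toeplitz \<alpha> w \<mu> f))
      else \<infinity>)"

definition average_function ::
  "(complex \<Rightarrow> real) \<Rightarrow> real \<Rightarrow> complex measure \<Rightarrow> complex \<Rightarrow> ennreal" where
  "average_function w r \<mu> z = emeasure \<mu> (ball z r) / weight_mass w (ball z r)"

definition berezin ::
  "real \<Rightarrow> (complex \<Rightarrow> real) \<Rightarrow> complex measure \<Rightarrow> complex \<Rightarrow> ennreal" where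
  "berezin \<alpha> w \<mu> z =
     (\<integral>\<^sup>+\<xi>. ennreal ((cmod (normalized_kernel \<alpha> w z \<xi>))\<^sup>2 * exp (- \<alpha> * (cmod \<xi>)\<^sup>2)) \<partial>\<mu>)"

definition bounded_on_plane :: "(complex \<Rightarrow> ennreal) \<Rightarrow> bool" where
  "bounded_on_plane g \<longleftrightarrow> (SUP z. g z) < \<infinity>"

definition comparable_on :: "'i set \<Rightarrow> ('i \<Rightarrow> ennreal) \<Rightarrow> ('i \<Rightarrow> ennreal) \<Rightarrow> bool" where
  "comparable_on I X Y \<longleftrightarrow>
     (\<exists>c>0. \<exists>C>0. \<forall>i\<in>I. ennreal c * Y i \<le> X i \<and> X i \<le> ennreal C * Y i)"

end

theory Submission
  imports Defs
begin

text \<open>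
  Let \<open>\<nu> = w dA\<close>. The only consequence of the hypothesis on \<open>w\<close> that matters is that, at one
  fixed scale \<open>\<rho>\<close>, \<open>\<nu> (ball x s) \<ge> c s\<^sup>m \<nu> (ball z \<rho>)\<close> whenever \<open>ball x s \<subseteq> ball z \<rho>\<close>; it follows
  from the \<open>A\<^sub>p\<close> condition by Markov's inequality. It gives doubling at scale \<open>\<rho>\<close>, exponential
  growth of \<open>\<nu>\<close> on large disks, and a local mean value bound for entire functions. Hence
  \<open>\<parallel>B\<^sub>z\<parallel>\<^sup>2 e\<^bsup>-\<alpha>|z|\<^sup>2\<^esup>\<close> is comparable to \<open>1 / \<nu> (ball z \<rho>)\<close>, and \<open>|B\<^sub>z|\<close> has the expected lower bound
  near the diagonal.

  The averages are then dominated by the Berezin transform, which is dominated by the Toeplitz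
  norm, since \<open>(T\<^sub>\<mu> b\<^sub>z)(z)\<close> is the Berezin transform times \<open>\<parallel>B\<^sub>z\<parallel>\<close>. Conversely, bounded averages
  make \<open>\<mu>\<close> a Carleson measure by Tonelli's theorem, and then the element representing the
  functional \<open>h \<mapsto> \<integral> h cnj f e\<^bsup>-\<alpha>|\<cdot>|\<^sup>2\<^esup> d\<mu>\<close> is \<open>T\<^sub>\<mu> f\<close>.
\<close>

section \<open>Spaces of square integrable entire functions\<close>

text \<open>Every constant is fixed before \<mu> is introduced, because the comparability has to be
  uniform in \<mu>. The claim then is a cycle: Berezin transform \<le> operator norm \<le> C
  (averages) \<le> C' (Berezin transform). Only the averages involve r, so passing from some radius
  to any radius costs nothing extra. Two obstacles shape the proof. The reproducing kernel is given
  by a description operator, so nothing is known about it before existence and uniqueness are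
  proved; the Hilbert space theory for this is built on genuine functions from a single local bound
  on point evaluations. And the kernel has no formula, so its size comes from extremal estimates and
  its lower bound near the diagonal from a Lipschitz estimate, which is effective only at a small
  distance and thereby limits \<delta>. Restricted weights may grow exponentially, like exp(Re z),
  so masses of disks are compared only at a fixed scale; the Gaussian factor absorbs the growth that
  accumulates over many such comparisons.\<close>

lemma cmod_add_mult_squared:
  "(cmod (a + c * b))\<^sup>2 = (cmod a)\<^sup>2 + 2 * Re (c * (b * cnj a)) + (cmod c)\<^sup>2 * (cmod b)\<^sup>2"
  unfolding cmod_power2 by (simp add: algebra_simps power2_eq_square)

lemma borel_measurable_cnj [measurable]:
  fixes g :: "'a \<Rightarrow> complex"
  shows "g \<in> borel_measurable M \<Longrightarrow> (\<lambda>x. cnj (g x)) \<in> borel_measurable M"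
  by (rule borel_measurable_continuous_on) (intro continuous_intros)

lemma integrable_mult_cnj:
  fixes f g :: "'a \<Rightarrow> complex"
  assumes [measurable]: "f \<in> borel_measurable M" "g \<in> borel_measurable M"
    and "integrable M (\<lambda>x. (cmod (f x))\<^sup>2)" "integrable M (\<lambda>x. (cmod (g x))\<^sup>2)"
  shows "integrable M (\<lambda>x. f x * cnj (g x))"
proof (rule Bochner_Integration.integrable_bound)
  show "integrable M (\<lambda>x. (cmod (f x))\<^sup>2 + (cmod (g x))\<^sup>2)"
    using assms by simp
  show "AE x in M. norm (f x * cnj (g x)) \<le> norm ((cmod (f x))\<^sup>2 + (cmod (g x))\<^sup>2)"
  proof (rule AE_I2)
    fix x
    have "2 * (cmod (f x) * cmod (g x)) \<le> (cmod (f x))\<^sup>2 + (cmod (g x))\<^sup>2"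
      using sum_squares_bound[of "cmod (f x)" "cmod (g x)"] by (simp add: mult.assoc)
    moreover have "0 \<le> cmod (f x) * cmod (g x)" by simp
    ultimately show "norm (f x * cnj (g x)) \<le> norm ((cmod (f x))\<^sup>2 + (cmod (g x))\<^sup>2)"
      unfolding norm_mult complex_mod_cnj real_norm_def by linarith
  qed
qed measurable

lemma integral_mult_cnj_bound:
  fixes f g :: "'a \<Rightarrow> complex"
  assumes [measurable]: "f \<in> borel_measurable M" "g \<in> borel_measurable M"
    and f: "integrable M (\<lambda>x. (cmod (f x))\<^sup>2)" and g: "integrable M (\<lambda>x. (cmod (g x))\<^sup>2)"
  shows "cmod (\<integral>x. f x * cnj (g x) \<partial>M)
           \<le> sqrt (\<integral>x. (cmod (f x))\<^sup>2 \<partial>M) * sqrt (\<integral>x. (cmod (g x))\<^sup>2 \<partial>M)"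
proof -
  define I where "I = (\<integral>x. cmod (f x) * cmod (g x) \<partial>M)"
  have int: "integrable M (\<lambda>x. cmod (f x) * cmod (g x))"
    using integrable_norm[OF integrable_mult_cnj[OF assms]] by (simp add: norm_mult)
  have "cmod (\<integral>x. f x * cnj (g x) \<partial>M) \<le> I"
    using integral_norm_bound[of M "\<lambda>x. f x * cnj (g x)"] by (simp add: I_def norm_mult)
  moreover have "I \<le> sqrt ((\<integral>x. (cmod (f x))\<^sup>2 \<partial>M) * (\<integral>x. (cmod (g x))\<^sup>2 \<partial>M))"
  proof (rule real_le_rsqrt)
    have sq: "ennreal (cmod z) ^ 2 = ennreal ((cmod z)\<^sup>2)" for z by (simp add: ennreal_power)
    have nn: "(\<integral>\<^sup>+x. ennreal (cmod (f x)) * ennreal (cmod (g x)) \<partial>M) = ennreal I"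
      unfolding I_def by (subst nn_integral_eq_integral[symmetric]) (auto simp: int ennreal_mult)
    have "ennreal (I\<^sup>2) \<le> (\<integral>\<^sup>+x. ennreal (cmod (f x)) ^ 2 \<partial>M) * (\<integral>\<^sup>+x. ennreal (cmod (g x)) ^ 2 \<partial>M)"
      using Cauchy_Schwarz_nn_integral[of "\<lambda>x. ennreal (cmod (f x))" M "\<lambda>x. ennreal (cmod (g x))"]
      unfolding nn by (simp add: ennreal_power I_def)
    also have "\<dots> = ennreal ((\<integral>x. (cmod (f x))\<^sup>2 \<partial>M) * (\<integral>x. (cmod (g x))\<^sup>2 \<partial>M))"
      unfolding sq by (subst (1 2) nn_integral_eq_integral) (auto simp: f g ennreal_mult)
    finally show "I\<^sup>2 \<le> (\<integral>x. (cmod (f x))\<^sup>2 \<partial>M) * (\<integral>x. (cmod (g x))\<^sup>2 \<partial>M)"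
      by (subst (asm) ennreal_le_iff) auto
  qed
  ultimately show ?thesis by (simp add: real_sqrt_mult)
qed

lemma entire_borel_measurable:
  assumes "f holomorphic_on UNIV" shows "f \<in> borel_measurable borel"
  using assms by (simp add: borel_measurable_continuous_onI holomorphic_on_imp_continuous_on)

section \<open>Entire functions square integrable for a measure, as a Hilbert space\<close>

definition entire_L2 :: "complex measure \<Rightarrow> (complex \<Rightarrow> complex) set" where
  "entire_L2 M = {f. f holomorphic_on UNIV \<and> integrable M (\<lambda>z. (cmod (f z))\<^sup>2)}"

text \<open>Locally uniform bounds on point evaluations turn norm convergence into locally uniform
  convergence, so that limits stay holomorphic, and make the seminorm \<open>sqn\<close> definite on
  functions rather than on classes modulo null sets.\<close>

locale entire_L2_space =
  fixes M :: "complex measure"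
  assumes sets_M [measurable_cong, simp]: "sets M = sets borel"
    and point_evaluation_bound: "\<And>R. \<exists>C. \<forall>f\<in>entire_L2 M. \<forall>z\<in>cball 0 R.
           (cmod (f z))\<^sup>2 \<le> C * (\<integral>x. (cmod (f x))\<^sup>2 \<partial>M)"
begin

abbreviation H :: "(complex \<Rightarrow> complex) set" where "H \<equiv> entire_L2 M"

definition sqn :: "(complex \<Rightarrow> complex) \<Rightarrow> real" where
  "sqn f = (\<integral>z. (cmod (f z))\<^sup>2 \<partial>M)"

definition ip :: "(complex \<Rightarrow> complex) \<Rightarrow> (complex \<Rightarrow> complex) \<Rightarrow> complex" where
  "ip f g = (\<integral>z. f z * cnj (g z) \<partial>M)"

lemma H_hol: "f \<in> H \<Longrightarrow> f holomorphic_on UNIV"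
  and H_int: "f \<in> H \<Longrightarrow> integrable M (\<lambda>z. (cmod (f z))\<^sup>2)"
  by (auto simp: entire_L2_def)

lemma H_meas [measurable_dest]: "f \<in> H \<Longrightarrow> f \<in> borel_measurable borel"
  using H_hol entire_borel_measurable by blast

lemma H_meas_M: "f \<in> H \<Longrightarrow> f \<in> borel_measurable M"
  using H_meas by (simp cong: measurable_cong_sets)

lemma sqn_nonneg [simp]: "0 \<le> sqn f"
  by (simp add: sqn_def)

lemma ip_integrable: "f \<in> H \<Longrightarrow> g \<in> H \<Longrightarrow> integrable M (\<lambda>z. f z * cnj (g z))"
  by (intro integrable_mult_cnj H_meas_M H_int)

lemma ip_bound: "f \<in> H \<Longrightarrow> g \<in> H \<Longrightarrow> cmod (ip f g) \<le> sqrt (sqn f) * sqrt (sqn g)"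
  unfolding ip_def sqn_def by (intro integral_mult_cnj_bound H_meas_M H_int)

lemma ip_self: "ip f f = of_real (sqn f)"
  unfolding ip_def sqn_def complex_norm_square[symmetric] by (rule integral_complex_of_real)

lemma zero_in_H: "(\<lambda>z. 0) \<in> H"
  by (simp add: entire_L2_def)

lemma add_mult_in_H:
  assumes "f \<in> H" "h \<in> H" shows "(\<lambda>z. f z + c * h z) \<in> H"
    and "sqn (\<lambda>z. f z + c * h z) = sqn f + 2 * Re (c * ip h f) + (cmod c)\<^sup>2 * sqn h"
proof -
  note int = H_int[OF assms(1)] H_int[OF assms(2)] ip_integrable[OF assms(2,1)]
  have Re: "Re (\<integral>z. c * (h z * cnj (f z)) \<partial>M) = (\<integral>z. Re (c * (h z * cnj (f z))) \<partial>M)"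
    by (rule integral_Re[symmetric]) (use int in auto)
  have intRe: "integrable M (\<lambda>z. Re (c * (h z * cnj (f z))))"
    by (rule integrable_Re) (use int in auto)
  show "(\<lambda>z. f z + c * h z) \<in> H"
    using int intRe H_hol[OF assms(1)] H_hol[OF assms(2)]
    by (auto simp only: entire_L2_def cmod_add_mult_squared mem_Collect_eq
        intro!: holomorphic_intros Bochner_Integration.integrable_add integrable_mult_right)
  define R where "R z = Re (c * (h z * cnj (f z)))" for z
  have "sqn (\<lambda>z. f z + c * h z)
      = (\<integral>z. (cmod (f z))\<^sup>2 + 2 * R z + (cmod c)\<^sup>2 * (cmod (h z))\<^sup>2 \<partial>M)"
    by (simp only: sqn_def cmod_add_mult_squared R_def)
  also have "\<dots> = sqn f + 2 * (\<integral>z. R z \<partial>M) + (cmod c)\<^sup>2 * sqn h"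
    using int(1,2) intRe[folded R_def] by (simp add: sqn_def)
  also have "(\<integral>z. R z \<partial>M) = Re (c * ip h f)"
    unfolding R_def Re[symmetric] ip_def by (subst integral_mult_right_zero) simp
  finally show "sqn (\<lambda>z. f z + c * h z) = sqn f + 2 * Re (c * ip h f) + (cmod c)\<^sup>2 * sqn h" .
qed

lemma mult_in_H: "h \<in> H \<Longrightarrow> (\<lambda>z. c * h z) \<in> H" and
  sqn_mult: "sqn (\<lambda>z. c * h z) = (cmod c)\<^sup>2 * sqn h"
  using add_mult_in_H(1)[OF zero_in_H, of h c]
  by (auto simp: sqn_def norm_mult power_mult_distrib)

lemma diff_in_H: "f \<in> H \<Longrightarrow> h \<in> H \<Longrightarrow> (\<lambda>z. f z - h z) \<in> H"
  using add_mult_in_H(1)[of f h "-1"] by simp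

lemma ip_diff_right: "f \<in> H \<Longrightarrow> g \<in> H \<Longrightarrow> h \<in> H \<Longrightarrow> ip f (\<lambda>z. g z - h z) = ip f g - ip f h"
  using ip_integrable[of f g] ip_integrable[of f h]
  by (simp add: ip_def right_diff_distrib)

lemma H_zero: assumes "f \<in> H" "sqn f = 0" shows "f z = 0"
proof -
  obtain C where "\<forall>f\<in>H. \<forall>z\<in>cball 0 (cmod z). (cmod (f z))\<^sup>2 \<le> C * (\<integral>x. (cmod (f x))\<^sup>2 \<partial>M)"
    using point_evaluation_bound by blast
  then have "(cmod (f z))\<^sup>2 \<le> C * sqn f" using assms by (auto simp: sqn_def)
  then show ?thesis using assms by simp
qed

text \<open>Completeness with an explicit rate. Point evaluation bounds make the sequence uniformly
  Cauchy on disks, so the pointwise limit is entire; Fatou's lemma in the second index then carries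
  the bound \<open>\<epsilon> n\<close> over to the limit.\<close>

lemma H_limit:
  assumes F: "\<And>n. F n \<in> H" and e: "\<epsilon> \<longlonglongrightarrow> 0"
    and Cauchy: "\<And>n k. n \<le> k \<Longrightarrow> sqn (\<lambda>z. F n z - F k z) \<le> \<epsilon> n"
  obtains G where "G \<in> H" "\<And>n. sqn (\<lambda>z. F n z - G z) \<le> \<epsilon> n"
proof -
  define G where "G z = lim (\<lambda>n. F n z)" for z
  have bd: "\<exists>C\<ge>0. \<forall>z\<in>cball 0 R. \<forall>n k. n \<le> k \<longrightarrow> (cmod (F n z - F k z))\<^sup>2 \<le> C * \<epsilon> n" for R
  proof -
    obtain C where C: "\<forall>f\<in>H. \<forall>z\<in>cball 0 R. (cmod (f z))\<^sup>2 \<le> C * (\<integral>x. (cmod (f x))\<^sup>2 \<partial>M)"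
      using point_evaluation_bound by blast
    have "(cmod (F n z - F k z))\<^sup>2 \<le> max C 0 * \<epsilon> n" if "z \<in> cball 0 R" "n \<le> k" for z n k
    proof -
      have "(cmod (F n z - F k z))\<^sup>2 \<le> C * sqn (\<lambda>z. F n z - F k z)"
        using bspec[OF bspec[OF C diff_in_H[OF F[of n] F[of k]]] that(1)] unfolding sqn_def .
      also have "\<dots> \<le> max C 0 * sqn (\<lambda>z. F n z - F k z)" by (rule mult_right_mono) auto
      also have "\<dots> \<le> max C 0 * \<epsilon> n" using Cauchy[OF that(2)] by (rule mult_left_mono) auto
      finally show ?thesis .
    qed
    then show ?thesis by (intro exI[of _ "max C 0"]) auto
  qed
  have small: "\<exists>N. \<forall>n\<ge>N. C * \<epsilon> n < d" if "d > 0" for C d :: real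
  proof -
    have "(\<lambda>n. C * \<epsilon> n) \<longlonglongrightarrow> C * 0" by (intro tendsto_intros e)
    then have "\<forall>\<^sub>F n in sequentially. C * \<epsilon> n < d"
      using that by (auto dest: order_tendstoD(2))
    then show ?thesis by (simp add: eventually_sequentially)
  qed
  have unif: "uniformly_Cauchy_on (cball 0 R) F" for R
  proof (rule uniformly_Cauchy_onI')
    fix d :: real assume "d > 0"
    obtain C where C: "\<forall>z\<in>cball 0 R. \<forall>n k. n \<le> k \<longrightarrow> (cmod (F n z - F k z))\<^sup>2 \<le> C * \<epsilon> n"
      using bd by blast
    obtain N where N: "\<forall>n\<ge>N. C * \<epsilon> n < d\<^sup>2" using small[of "d\<^sup>2"] \<open>d > 0\<close> by auto
    have "dist (F m x) (F n x) < d" if "x \<in> cball 0 R" "m \<ge> N" "n > m" for x m n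
    proof -
      have "(cmod (F m x - F n x))\<^sup>2 < d\<^sup>2"
        using C N that by (meson le_less_trans less_imp_le)
      then show ?thesis using \<open>d > 0\<close> by (simp add: dist_norm power2_less_imp_less)
    qed
    then show "\<exists>M. \<forall>x\<in>cball 0 R. \<forall>m\<ge>M. \<forall>n>m. dist (F m x) (F n x) < d" by blast
  qed
  have ulim: "uniform_limit (cball 0 R) F G sequentially" for R
    using uniformly_convergent_uniform_limit_iff[of "cball 0 R" F]
      Cauchy_uniformly_convergent[OF unif[of R]] unfolding G_def by simp
  have ptw: "(\<lambda>n. F n z) \<longlonglongrightarrow> G z" for z
    by (rule tendsto_uniform_limitI[OF ulim[of "cmod z"]]) simp
  have "G holomorphic_on UNIV"
  proof (rule holomorphic_uniform_sequence[of UNIV F])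
    show "F n holomorphic_on UNIV" for n using F H_hol by blast
    show "\<exists>d>0. cball x d \<subseteq> UNIV \<and> uniform_limit (cball x d) F G sequentially" for x
    proof (intro exI[of _ 1] conjI)
      have "cball x 1 \<subseteq> cball 0 (cmod x + 1)"
        by (simp add: subset_iff dist_norm) (metis norm_minus_commute norm_triangle_sub add.commute
            add_left_mono order_trans)
      then show "uniform_limit (cball x 1) F G sequentially"
        by (rule uniform_limit_on_subset[OF ulim])
    qed auto
  qed auto
  have Gm [measurable]: "G \<in> borel_measurable borel"
    by (rule entire_borel_measurable) fact
  have Fm [measurable]: "F n \<in> borel_measurable borel" for n using F H_meas by blast
  have fatou: "(\<integral>\<^sup>+z. ennreal ((cmod (F n z - G z))\<^sup>2) \<partial>M) \<le> ennreal (\<epsilon> n)" for n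
  proof -
    have "(\<integral>\<^sup>+z. ennreal ((cmod (F n z - G z))\<^sup>2) \<partial>M)
        = (\<integral>\<^sup>+z. liminf (\<lambda>k. ennreal ((cmod (F n z - F k z))\<^sup>2)) \<partial>M)"
    proof (rule nn_integral_cong)
      fix z
      have "(\<lambda>k. ennreal ((cmod (F n z - F k z))\<^sup>2)) \<longlonglongrightarrow> ennreal ((cmod (F n z - G z))\<^sup>2)"
        by (intro tendsto_intros ptw)
      then show "ennreal ((cmod (F n z - G z))\<^sup>2) = liminf (\<lambda>k. ennreal ((cmod (F n z - F k z))\<^sup>2))"
        by (rule lim_imp_Liminf[symmetric, rotated]) simp
    qed
    also have "\<dots> \<le> liminf (\<lambda>k. \<integral>\<^sup>+z. ennreal ((cmod (F n z - F k z))\<^sup>2) \<partial>M)"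
      by (rule nn_integral_liminf) measurable
    also have "\<dots> \<le> limsup (\<lambda>k. \<integral>\<^sup>+z. ennreal ((cmod (F n z - F k z))\<^sup>2) \<partial>M)"
      by (rule Liminf_le_Limsup) simp
    also have "\<dots> \<le> ennreal (\<epsilon> n)"
    proof (rule Limsup_bounded, rule eventually_sequentiallyI[of n])
      fix k assume "n \<le> k"
      have "(\<integral>\<^sup>+z. ennreal ((cmod (F n z - F k z))\<^sup>2) \<partial>M) = ennreal (sqn (\<lambda>z. F n z - F k z))"
        unfolding sqn_def by (intro nn_integral_eq_integral H_int diff_in_H F) auto
      then show "(\<integral>\<^sup>+z. ennreal ((cmod (F n z - F k z))\<^sup>2) \<partial>M) \<le> ennreal (\<epsilon> n)"
        using Cauchy[OF \<open>n \<le> k\<close>] by (simp add: ennreal_leI)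
    qed
    finally show ?thesis .
  qed
  have e0: "0 \<le> \<epsilon> n" for n using Cauchy[of n n] by (rule order_trans[rotated]) auto
  have D: "(\<lambda>z. F n z - G z) \<in> H" for n
  proof -
    have "integrable M (\<lambda>z. (cmod (F n z - G z))\<^sup>2)"
    proof (rule integrableI_bounded)
      show "(\<integral>\<^sup>+z. ennreal (norm ((cmod (F n z - G z))\<^sup>2)) \<partial>M) < \<infinity>"
        using le_less_trans[OF fatou[of n] ennreal_less_top] by simp
    qed measurable
    then show ?thesis
      using \<open>G holomorphic_on UNIV\<close> H_hol[OF F[of n]]
      by (auto simp: entire_L2_def intro!: holomorphic_intros)
  qed
  \<comment> \<open>Here \<open>G\<close> is recovered as the difference of \<open>F 0\<close> and
    \<open>F 0 - G\<close>.\<close>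
  have "G \<in> H" using diff_in_H[OF F[of 0] D[of 0]] by simp
  moreover have "sqn (\<lambda>z. F n z - G z) \<le> \<epsilon> n" for n
  proof -
    have "ennreal (sqn (\<lambda>z. F n z - G z)) = (\<integral>\<^sup>+z. ennreal ((cmod (F n z - G z))\<^sup>2) \<partial>M)"
      unfolding sqn_def by (intro nn_integral_eq_integral[symmetric] H_int D) auto
    then show ?thesis using fatou[of n] e0 by (metis ennreal_le_iff)
  qed
  ultimately show ?thesis using that by blast
qed

text \<open>The representing element minimises \<open>\<parallel>f\<parallel>\<^sup>2 - 2 Re (L f)\<close>; the parallelogram law makes
  every minimising sequence Cauchy.\<close>

theorem Riesz_representation:
  assumes lin: "\<And>f h c. f \<in> H \<Longrightarrow> h \<in> H \<Longrightarrow> L (\<lambda>z. f z + c * h z) = L f + c * L h"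
    and bdd: "\<And>f. f \<in> H \<Longrightarrow> cmod (L f) \<le> C * sqrt (sqn f)"
  obtains g where "g \<in> H" "\<And>f. f \<in> H \<Longrightarrow> L f = ip f g"
proof -
  define Q where "Q f = sqn f - 2 * Re (L f)" for f
  have Qadd: "Q (\<lambda>z. f z + c * h z) = Q f + 2 * Re (c * (ip h f - L h)) + (cmod c)\<^sup>2 * sqn h"
    if "f \<in> H" "h \<in> H" for f h c
    using that by (simp add: Q_def lin add_mult_in_H(2) algebra_simps)
  have Qlow: "- C\<^sup>2 \<le> Q f" if "f \<in> H" for f
  proof -
    have "Re (L f) \<le> C * sqrt (sqn f)" using bdd[OF that] complex_Re_le_cmod order_trans by blast
    moreover have "0 \<le> (sqrt (sqn f) - C)\<^sup>2" by simp
    ultimately show ?thesis by (simp add: Q_def power2_diff mult.commute mult.left_commute)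
  qed
  define I where "I = Inf (Q ` H)"
  have ne: "Q ` H \<noteq> {}" using zero_in_H by blast
  have bb: "bdd_below (Q ` H)" using Qlow by (intro bdd_belowI2[of _ "- C\<^sup>2"])
  have IQ: "I \<le> Q f" if "f \<in> H" for f unfolding I_def using that bb by (simp add: cINF_lower)
  have "\<exists>f\<in>H. Q f < I + inverse (real (Suc n))" for n
    using cInf_lessD[OF ne, of "I + inverse (real (Suc n))"] unfolding I_def by auto
  then obtain F where F: "\<And>n. F n \<in> H" and QF: "\<And>n. Q (F n) < I + inverse (real (Suc n))"
    by metis
  \<comment> \<open>Parallelogram law. The linear part of \<open>Q\<close> cancels because
    \<open>L\<close> at the midpoint is the mean of its two values.\<close>
  have par: "sqn (\<lambda>z. f z - h z) = 2 * (Q f + Q h - 2 * Q (\<lambda>z. (1/2) * (f z + 1 * h z)))"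
    if f: "f \<in> H" and h: "h \<in> H" for f h
  proof -
    have s: "(\<lambda>z. f z + 1 * h z) \<in> H" by (rule add_mult_in_H(1)[OF that])
    \<comment> \<open>Homogeneity is contained in \<open>lin\<close>: the instance with both
      functions zero gives that \<open>L\<close> vanishes at zero, and the instance with first
      function zero then gives scaling.\<close>
    have "L (\<lambda>z. (1/2) * (f z + 1 * h z)) = (1/2) * L (\<lambda>z. f z + 1 * h z)"
      using lin[OF zero_in_H s, of "1/2"] lin[OF zero_in_H zero_in_H, of 1] by simp
    also have "\<dots> = (1/2) * (L f + L h)" using lin[OF f h, of 1] by simp
    finally have L: "L (\<lambda>z. (1/2) * (f z + 1 * h z)) = (1/2) * (L f + L h)" .
    have ReL: "Re (L (\<lambda>z. (1/2) * (f z + 1 * h z))) = (Re (L f) + Re (L h)) / 2"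
      unfolding L by simp
    have S: "sqn (\<lambda>z. (1/2) * (f z + 1 * h z)) = (sqn f + 2 * Re (ip h f) + sqn h) / 4"
      using add_mult_in_H(2)[OF f h, of 1] by (simp only: sqn_mult) (simp add: power2_eq_square)
    show ?thesis
      using add_mult_in_H(2)[OF f h, of "-1"] unfolding Q_def S ReL by (simp add: field_simps)
  qed
  \<comment> \<open>Two elements whose \<open>Q\<close> exceeds the infimum by at most 1/(n+1) and
    1/(k+1) have squared distance at most 2 (1/(n+1) + 1/(k+1)), which is at most
    \<open>\<epsilon> n\<close> for k \<ge> n.\<close>
  define \<epsilon> where "\<epsilon> n = 4 * inverse (real (Suc n))" for n
  have e0: "\<epsilon> \<longlonglongrightarrow> 0"
    unfolding \<epsilon>_def using tendsto_mult[OF tendsto_const LIMSEQ_inverse_real_of_nat, of 4] by simp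
  have "sqn (\<lambda>z. F n z - F k z) \<le> \<epsilon> n" if "n \<le> k" for n k
  proof -
    have "(\<lambda>z. (1/2) * (F n z + 1 * F k z)) \<in> H"
      by (intro mult_in_H add_mult_in_H(1) F)
    then have "I \<le> Q (\<lambda>z. (1/2) * (F n z + 1 * F k z))" by (rule IQ)
    moreover have "inverse (real (Suc k)) \<le> inverse (real (Suc n))"
      using that by (intro le_imp_inverse_le) auto
    ultimately show ?thesis
      unfolding \<epsilon>_def par[OF F[of n] F[of k]] using QF[of n] QF[of k] by argo
  qed
  from H_limit[OF F e0 this] obtain G where G: "G \<in> H" and GF: "\<And>n. sqn (\<lambda>z. F n z - G z) \<le> \<epsilon> n"
    by blast
  have "L h = ip h G" if h: "h \<in> H" for h
  proof -
    define a where "a n = ip h (F n) - L h" for n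
    have bound: "(cmod (a n))\<^sup>2 \<le> (sqn h + 1) * \<epsilon> n" for n
    proof -
      have pos: "0 < sqn h + 1" using sqn_nonneg[of h] by linarith
      \<comment> \<open>Step size for moving \<open>F n\<close> against the direction
        \<open>h\<close>. Since \<open>t * sqn h \<le> 1\<close>, the quadratic term cancels at most
        half of the linear gain; the summand 1 keeps the denominator positive when \<open>h\<close>
        has norm zero.\<close>
      define t where "t = 1 / (sqn h + 1)"
      have t: "0 < t" "t * sqn h \<le> 1" using pos by (auto simp: t_def field_simps)
      have "I \<le> Q (\<lambda>z. F n z + (- (of_real t * cnj (a n))) * h z)"
        by (intro IQ add_mult_in_H(1) F h)
      also have "\<dots> = Q (F n) + 2 * Re (- (of_real t * cnj (a n)) * a n)
          + (cmod (- (of_real t * cnj (a n))))\<^sup>2 * sqn h"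
        unfolding Qadd[OF F h] by (simp add: a_def)
      also have "Re (- (of_real t * cnj (a n)) * a n) = - t * (cmod (a n))\<^sup>2"
        by (simp add: cmod_power2) (simp add: algebra_simps power2_eq_square)
      also have "(cmod (- (of_real t * cnj (a n))))\<^sup>2 * sqn h = t * (cmod (a n))\<^sup>2 * (t * sqn h)"
        by (simp add: norm_mult power2_eq_square)
      also have "\<dots> \<le> t * (cmod (a n))\<^sup>2 * 1"
        using t by (intro mult_left_mono) auto
      finally have "t * (cmod (a n))\<^sup>2 \<le> Q (F n) - I" by simp
      also have "\<dots> \<le> \<epsilon> n" unfolding \<epsilon>_def using QF[of n] by (simp add: field_simps)
      finally have "t * (cmod (a n))\<^sup>2 \<le> \<epsilon> n" .
      then show ?thesis using pos by (simp add: t_def field_simps)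
    qed
    have "(\<lambda>n. (cmod (a n))\<^sup>2) \<longlonglongrightarrow> 0"
    proof (rule tendsto_sandwich[of "\<lambda>_. 0" _ _ "\<lambda>n. (sqn h + 1) * \<epsilon> n"])
      show "(\<lambda>n. (sqn h + 1) * \<epsilon> n) \<longlonglongrightarrow> 0" using tendsto_mult_right_zero[OF e0] by simp
    qed (auto simp: bound)
    then have "(\<lambda>n. cmod (a n)) \<longlonglongrightarrow> 0"
      using tendsto_real_sqrt[of "\<lambda>n. (cmod (a n))\<^sup>2" 0] by simp
    moreover have "(\<lambda>n. cmod (ip h (F n) - ip h G)) \<longlonglongrightarrow> 0"
    proof (rule tendsto_sandwich[of "\<lambda>_. 0" _ _ "\<lambda>n. sqrt (sqn h) * sqrt (\<epsilon> n)"])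
      have "(\<lambda>n. sqrt (\<epsilon> n)) \<longlonglongrightarrow> sqrt 0" by (intro tendsto_real_sqrt e0)
      then show "(\<lambda>n. sqrt (sqn h) * sqrt (\<epsilon> n)) \<longlonglongrightarrow> 0"
        by (simp add: tendsto_mult_right_zero)
      have "cmod (ip h (F n) - ip h G) \<le> sqrt (sqn h) * sqrt (\<epsilon> n)" for n
      proof -
        have "cmod (ip h (\<lambda>z. F n z - G z)) \<le> sqrt (sqn h) * sqrt (sqn (\<lambda>z. F n z - G z))"
          by (intro ip_bound h diff_in_H F G)
        also have "\<dots> \<le> sqrt (sqn h) * sqrt (\<epsilon> n)"
          using GF[of n] by (intro mult_left_mono) auto
        finally show ?thesis by (simp add: ip_diff_right h F G)
      qed
      then show "\<forall>\<^sub>F n in sequentially. cmod (ip h (F n) - ip h G) \<le> sqrt (sqn h) * sqrt (\<epsilon> n)"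
        by simp
    qed auto
    ultimately have "(\<lambda>n. cmod (ip h (F n) - ip h G) + cmod (a n)) \<longlonglongrightarrow> 0 + 0"
      by (intro tendsto_add)
    moreover have "cmod (L h - ip h G) \<le> cmod (ip h (F n) - ip h G) + cmod (a n)" for n
      unfolding a_def using norm_triangle_ineq4[of "ip h (F n) - ip h G" "ip h (F n) - L h"] by simp
    ultimately have "cmod (L h - ip h G) \<le> 0 + 0"
      by (intro LIMSEQ_le_const) auto
    then show ?thesis by simp
  qed
  then show ?thesis using G that by blast
qed

text \<open>Has the same shape as \<open>rep_kernel\<close>, so the two agree as soon as the spaces
  and inner products are identified.\<close>

definition kernel :: "complex \<Rightarrow> complex \<Rightarrow> complex" where
  "kernel z = (THE g. g \<in> H \<and> (\<forall>f\<in>H. f z = ip f g))"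

lemma kernel_in_H: "kernel z \<in> H"
  and kernel_reproducing: "f \<in> H \<Longrightarrow> ip f (kernel z) = f z"
proof -
  obtain C where C: "\<forall>f\<in>H. \<forall>u\<in>cball 0 (cmod z). (cmod (f u))\<^sup>2 \<le> C * (\<integral>x. (cmod (f x))\<^sup>2 \<partial>M)"
    using point_evaluation_bound by blast
  have "cmod (f z) \<le> sqrt C * sqrt (sqn f)" if "f \<in> H" for f
    using C that by (simp add: real_sqrt_mult[symmetric] sqn_def real_le_rsqrt)
  then obtain g where g: "g \<in> H" "\<And>f. f \<in> H \<Longrightarrow> f z = ip f g"
    using Riesz_representation[of "\<lambda>f. f z" "sqrt C"] by blast
  have "\<exists>!g. g \<in> H \<and> (\<forall>f\<in>H. f z = ip f g)"
  proof (rule ex1I)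
    show "g \<in> H \<and> (\<forall>f\<in>H. f z = ip f g)" using g by blast
    fix h assume h: "h \<in> H \<and> (\<forall>f\<in>H. f z = ip f h)"
    define d where "d u = h u - g u" for u
    have d: "d \<in> H" unfolding d_def using g h by (intro diff_in_H) auto
    then have "ip d h = ip d g" using g h by metis
    then have "ip d d = 0"
      using ip_diff_right[OF d, of h g] g h by (simp add: d_def[abs_def])
    then have "sqn d = 0" by (simp add: ip_self)
    then show "h = g" using H_zero[OF d] by (auto simp: d_def fun_eq_iff)
  qed
  from theI'[OF this] show "kernel z \<in> H" "f \<in> H \<Longrightarrow> ip f (kernel z) = f z"
    unfolding kernel_def[symmetric] by auto
qed

lemma kernel_diag: "kernel z z = of_real (sqn (kernel z))"
  using kernel_reproducing[OF kernel_in_H, of z z] by (simp add: ip_self)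

lemma point_le_kernel: "f \<in> H \<Longrightarrow> cmod (f z) \<le> sqrt (sqn f) * sqrt (sqn (kernel z))"
  using ip_bound[OF _ kernel_in_H, of f z] by (simp add: kernel_reproducing)

text \<open>Recognising \<open>T\<close> as an element supplied by the Riesz theorem yields
  holomorphy, square integrability and the norm bound together, without differentiating under the
  integral. The link is that the conjugate of \<open>T z\<close> is the functional evaluated at
  \<open>kernel z\<close>. In the application \<open>N\<close> is \<mu> with the Gaussian as
  density.\<close>

lemma toeplitz_bounded_if_Carleson:
  fixes N :: "complex measure"
  assumes N [measurable_cong]: "sets N = sets borel" and "0 \<le> C"
    and Carleson: "\<And>f. f \<in> H \<Longrightarrow> (\<integral>\<^sup>+z. ennreal ((cmod (f z))\<^sup>2) \<partial>N) \<le> ennreal (C * sqn f)"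
    and f: "f \<in> H"
  defines "T \<equiv> \<lambda>z. \<integral>x. f x * cnj (kernel z x) \<partial>N"
  shows "integrable N (\<lambda>x. f x * cnj (kernel z x))" "T \<in> H"
    "sqrt (sqn T) \<le> C * sqrt (sqn f)"
proof -
  have meas: "h \<in> borel_measurable N" if "h \<in> H" for h
    using H_meas[OF that] N by (simp cong: measurable_cong_sets)
  have intN: "integrable N (\<lambda>z. (cmod (h z))\<^sup>2)" if "h \<in> H" for h
  proof (rule integrableI_bounded)
    show "(\<integral>\<^sup>+z. ennreal (norm ((cmod (h z))\<^sup>2)) \<partial>N) < \<infinity>"
      using le_less_trans[OF Carleson[OF that] ennreal_less_top] by simp
  qed (use meas[OF that] in measurable)
  have leN: "(\<integral>z. (cmod (h z))\<^sup>2 \<partial>N) \<le> C * sqn h" if "h \<in> H" for h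
  proof -
    have "ennreal (\<integral>z. (cmod (h z))\<^sup>2 \<partial>N) = (\<integral>\<^sup>+z. ennreal ((cmod (h z))\<^sup>2) \<partial>N)"
      by (intro nn_integral_eq_integral[symmetric] intN that) auto
    with Carleson[OF that] show ?thesis
      using \<open>0 \<le> C\<close> by (metis ennreal_le_iff mult_nonneg_nonneg sqn_nonneg)
  qed
  have int: "integrable N (\<lambda>x. h x * cnj (k x))" if "h \<in> H" "k \<in> H" for h k
    using that by (intro integrable_mult_cnj meas intN)
  show "integrable N (\<lambda>x. f x * cnj (kernel z x))"
    by (intro int f kernel_in_H)
  define L where "L h = (\<integral>x. h x * cnj (f x) \<partial>N)" for h
  have bd: "cmod (L h) \<le> C * sqrt (sqn f) * sqrt (sqn h)" if "h \<in> H" for h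
  proof -
    have "cmod (L h) \<le> sqrt (\<integral>x. (cmod (h x))\<^sup>2 \<partial>N) * sqrt (\<integral>x. (cmod (f x))\<^sup>2 \<partial>N)"
      unfolding L_def by (intro integral_mult_cnj_bound meas intN that f)
    also have "\<dots> \<le> sqrt (C * sqn h) * sqrt (C * sqn f)"
      using \<open>0 \<le> C\<close> by (intro mult_mono real_sqrt_le_mono leN that f) auto
    also have "\<dots> = (sqrt C * sqrt C) * sqrt (sqn f) * sqrt (sqn h)"
      by (simp add: real_sqrt_mult)
    finally show ?thesis using \<open>0 \<le> C\<close> by simp
  qed
  have lin: "L (\<lambda>z. h z + c * k z) = L h + c * L k" if "h \<in> H" "k \<in> H" for h k c
    using int[OF that(1) f] int[OF that(2) f]
    by (simp add: L_def distrib_right mult.assoc)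
  obtain g where g: "g \<in> H" "\<And>h. h \<in> H \<Longrightarrow> L h = ip h g"
    using Riesz_representation[OF lin bd] by blast
  have "T = g"
  proof
    fix z
    have "cnj (T z) = (\<integral>x. cnj (f x * cnj (kernel z x)) \<partial>N)"
      unfolding T_def by (rule Bochner_Integration.integral_cnj[symmetric])
    also have "\<dots> = L (kernel z)" by (simp add: L_def mult.commute)
    also have "\<dots> = ip (kernel z) g" by (intro g kernel_in_H)
    also have "\<dots> = (\<integral>x. cnj (g x * cnj (kernel z x)) \<partial>M)" by (simp add: ip_def mult.commute)
    also have "\<dots> = cnj (ip g (kernel z))" unfolding ip_def by (rule Bochner_Integration.integral_cnj)
    also have "\<dots> = cnj (g z)" using kernel_reproducing[OF g(1)] by simp
    finally show "T z = g z" by simp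
  qed
  then show "T \<in> H" using g by simp
  \<comment> \<open>The functional is tested on its own representing element; one factor
    \<open>sqrt (sqn g)\<close> is then cancelled.\<close>
  have "sqn g \<le> C * sqrt (sqn f) * sqrt (sqn g)"
    using bd[OF g(1)] g(2)[OF g(1)] by (simp add: ip_self)
  then have *: "sqrt (sqn g) * sqrt (sqn g) \<le> (C * sqrt (sqn f)) * sqrt (sqn g)"
    by simp
  then have "sqrt (sqn g) \<le> C * sqrt (sqn f)"
  proof (cases "sqn g = 0")
    case False
    then have "0 < sqrt (sqn g)" by (simp add: order.strict_iff_order)
    then show ?thesis using * by (rule mult_right_le_imp_le[rotated])
  qed (use \<open>0 \<le> C\<close> in simp)
  then show "sqrt (sqn T) \<le> C * sqrt (sqn f)" using \<open>T = g\<close> by simp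
qed

text \<open>With \<open>b\<close> the normalised kernel, \<open>(T b)(z) = \<parallel>K\<^sub>z\<parallel> \<integral>|b|\<^sup>2\<close>, while reproduction bounds
  the left-hand side by \<open>\<parallel>T b\<parallel> \<parallel>K\<^sub>z\<parallel>\<close>.\<close>

lemma berezin_le_toeplitz_norm:
  fixes N :: "complex measure"
  defines "T \<equiv> \<lambda>f z. \<integral>x. f x * cnj (kernel z x) \<partial>N"
  assumes int: "\<And>f z. f \<in> H \<Longrightarrow> integrable N (\<lambda>x. f x * cnj (kernel z x))"
    and T: "\<And>f. f \<in> H \<Longrightarrow> T f \<in> H"
    and C: "\<And>f. f \<in> H \<Longrightarrow> sqn f \<le> 1 \<Longrightarrow> ennreal (sqrt (sqn (T f))) \<le> C"
  shows "(\<integral>\<^sup>+x. ennreal ((cmod (kernel z x / of_real (sqrt (sqn (kernel z)))))\<^sup>2) \<partial>N) \<le> C"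
proof (cases "sqn (kernel z) = 0")
  \<comment> \<open>In the other case the normalised kernel is a quotient by zero, hence zero, and
    the left-hand side vanishes.\<close>
  case False
  define n where "n = sqrt (sqn (kernel z))"
  have n: "n > 0" using False by (simp add: n_def order.strict_iff_order)
  define b where "b x = kernel z x / of_real n" for x
  have b_eq: "b = (\<lambda>x. of_real (inverse n) * kernel z x)"
    by (auto simp: b_def fun_eq_iff field_simps)
  have b: "b \<in> H" unfolding b_eq by (intro mult_in_H kernel_in_H)
  have "sqn b = 1"
    unfolding b_eq sqn_mult using n False by (simp add: n_def norm_inverse power_inverse)
  have kb: "kernel z x = of_real n * b x" for x using n by (simp add: b_def)
  have bb: "b x * cnj (kernel z x) = of_real (n * (cmod (b x))\<^sup>2)" for x
  proof -
    have "b x * cnj (kernel z x) = of_real n * (b x * cnj (b x))" by (simp add: kb)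
    also have "b x * cnj (b x) = of_real ((cmod (b x))\<^sup>2)" by (simp only: complex_norm_square)
    finally show ?thesis by (simp only: of_real_mult)
  qed
  have "integrable N (\<lambda>x. complex_of_real (n * (cmod (b x))\<^sup>2))"
    using int[OF b, of z] unfolding bb .
  then have "integrable N (\<lambda>x. n * (cmod (b x))\<^sup>2)"
    by (simp only: complex_of_real_integrable_eq)
  then have intb: "integrable N (\<lambda>x. (cmod (b x))\<^sup>2)" using n by simp
  have "T b z = of_real (n * (\<integral>x. (cmod (b x))\<^sup>2 \<partial>N))"
    unfolding T_def bb integral_complex_of_real by simp
  then have "n * (\<integral>x. (cmod (b x))\<^sup>2 \<partial>N) = cmod (T b z)"
    using n by (simp add: norm_mult)
  also have "\<dots> \<le> sqrt (sqn (T b)) * n"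
    unfolding n_def by (rule point_le_kernel[OF T[OF b]])
  finally have "(\<integral>x. (cmod (b x))\<^sup>2 \<partial>N) \<le> sqrt (sqn (T b))" using n by simp
  then have "ennreal (\<integral>x. (cmod (b x))\<^sup>2 \<partial>N) \<le> C"
    using C[OF b] \<open>sqn b = 1\<close> by (intro order_trans[OF ennreal_leI C[OF b]]) auto
  then show ?thesis
    using nn_integral_eq_integral[OF intb] by (simp add: b_def n_def)
qed simp

end

section \<open>Measures with a power lower bound on small disks\<close>

text \<open>Disks of radius d/2 about points of the inner half disk stay inside
  \<open>cball \<zeta> d\<close>, so Cauchy's estimate bounds the derivative there.\<close>

lemma holomorphic_Lipschitz_bound:
  assumes hol: "f holomorphic_on UNIV" and d: "0 < d"
    and B: "\<And>x. x \<in> cball \<zeta> d \<Longrightarrow> cmod (f x) \<le> B"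
    and x: "cmod (x - \<zeta>) < d / 2"
  shows "cmod (f x - f \<zeta>) \<le> 2 * B / d * cmod (x - \<zeta>)"
proof (rule field_differentiable_bound[of "ball \<zeta> (d/2)" f "deriv f"])
  fix z assume z: "z \<in> ball \<zeta> (d/2)"
  show "(f has_field_derivative deriv f z) (at z within ball \<zeta> (d/2))"
    using hol by (meson UNIV_I holomorphic_derivI open_UNIV has_field_derivative_at_within)
  have "norm ((deriv ^^ 1) f z) \<le> fact 1 * B / (d/2) ^ 1"
  proof (rule Cauchy_inequality)
    show "f holomorphic_on ball z (d/2)" using hol holomorphic_on_subset by blast
    show "continuous_on (cball z (d/2)) f"
      using hol holomorphic_on_imp_continuous_on continuous_on_subset by blast
    show "norm (f x) \<le> B" if "norm (z - x) = d / 2" for x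
    proof (rule B)
      have "dist \<zeta> x \<le> dist \<zeta> z + dist z x" by (rule dist_triangle)
      then show "x \<in> cball \<zeta> d" using z that by (simp add: dist_norm)
    qed
  qed (use d in auto)
  then show "norm (deriv f z) \<le> 2 * B / d" by (simp add: field_simps)
qed (use d x in \<open>auto simp: dist_norm norm_minus_commute\<close>)

lemma ball_in_borel [measurable]: "ball (z::'a::metric_space) r \<in> sets borel"
  by simp

text \<open>For a weight in the class the natural exponent is 2p; rounding it up to a natural number
  \<open>m\<close> is harmless because only radii up to \<rho> occur.\<close>

locale doubling_measure =
  fixes \<nu> :: "complex measure" and \<rho> c :: real and m :: nat
  assumes sets_\<nu> [measurable_cong, simp]: "sets \<nu> = sets borel"
    and \<rho>_pos: "0 < \<rho>" and c_pos: "0 < c" and m_pos: "0 < m"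
    and finite_ball: "\<And>z. emeasure \<nu> (ball z \<rho>) < \<infinity>"
    and ball_pos: "\<And>z. 0 < emeasure \<nu> (ball z \<rho>)"
    and subball: "\<And>x z s. 0 < s \<Longrightarrow> ball x s \<subseteq> ball z \<rho> \<Longrightarrow>
          ennreal (c * s ^ m) * emeasure \<nu> (ball z \<rho>) \<le> emeasure \<nu> (ball x s)"
begin

section \<open>Masses of disks at the fixed scale\<close>

definition V :: "complex \<Rightarrow> real" where "V z = measure \<nu> (ball z \<rho>)"

lemma emeasure_V: "emeasure \<nu> (ball z \<rho>) = ennreal (V z)"
  unfolding V_def using finite_ball[of z] by (simp add: emeasure_eq_ennreal_measure)

lemma V_pos: "0 < V z"
  using ball_pos[of z] by (simp add: emeasure_V)

lemma ball_lower:
  assumes "0 < s" "ball x s \<subseteq> ball z \<rho>"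
  shows "ennreal (c * s ^ m * V z) \<le> emeasure \<nu> (ball x s)"
  using subball[OF assms] by (simp only: emeasure_V ennreal_mult''[OF less_imp_le[OF V_pos]])

definition K :: real where "K = inverse (c * (\<rho> / 2) ^ m)"

lemma K_pos: "0 < K" using c_pos \<rho>_pos by (simp add: K_def)

text \<open>The disk of radius \<rho>/2 about the midpoint lies in both disks: it carries a fixed
  share of the mass of the first and at most the mass of the second.\<close>

lemma V_doubling:
  assumes "dist z u \<le> \<rho>" shows "V z \<le> K * V u"
proof -
  let ?x = "midpoint z u"
  have sub: "ball ?x (\<rho> / 2) \<subseteq> ball y \<rho>" if "dist y ?x \<le> \<rho> / 2" for y
  proof
    fix x assume "x \<in> ball ?x (\<rho> / 2)"
    then show "x \<in> ball y \<rho>" using that dist_triangle[of y x ?x] by simp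
  qed
  have z: "dist z ?x \<le> \<rho> / 2" and u: "dist u ?x \<le> \<rho> / 2"
    using assms by (simp_all add: dist_midpoint)
  have "ennreal (c * (\<rho> / 2) ^ m * V z) \<le> emeasure \<nu> (ball ?x (\<rho> / 2))"
    using \<rho>_pos by (intro ball_lower sub z) auto
  also have "\<dots> \<le> emeasure \<nu> (ball u \<rho>)" by (intro emeasure_mono sub u) auto
  finally have "c * (\<rho> / 2) ^ m * V z \<le> V u"
    using less_imp_le[OF V_pos] by (simp add: emeasure_V)
  then show ?thesis using c_pos \<rho>_pos unfolding K_def by (simp add: field_simps)
qed

text \<open>Each enlargement of the radius by \<rho> costs a fixed factor. One finite cover of
  \<open>cball 0 (2 * \<rho>)\<close> by disks of radius \<rho> serves at every stage, and its
  centres are at most two doubling steps away from the origin.\<close>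

lemma ball_growth:
  obtains A where "1 \<le> A" "\<And>n z. emeasure \<nu> (ball z (real n * \<rho>)) \<le> ennreal (A ^ n * V z)"
proof -
  have "compact (cball (0::complex) (2 * \<rho>))" by simp
  moreover have "\<And>a. a \<in> cball (0::complex) (2 * \<rho>) \<Longrightarrow> open (ball a \<rho>)" by simp
  moreover have "cball (0::complex) (2 * \<rho>) \<subseteq> (\<Union>a\<in>cball 0 (2*\<rho>). ball a \<rho>)"
    using \<rho>_pos by force
  ultimately obtain S where S: "S \<subseteq> cball (0::complex) (2 * \<rho>)" "finite S"
    "cball 0 (2 * \<rho>) \<subseteq> (\<Union>a\<in>S. ball a \<rho>)"
    by (rule compactE_image)
  define A where "A = max 1 (real (card S) * K\<^sup>2)"
  have A: "1 \<le> A" "real (card S) * K\<^sup>2 \<le> A" by (auto simp: A_def)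
  have VK: "V (z + a) \<le> K\<^sup>2 * V z" if "a \<in> S" for a z
  proof -
    have "cmod a \<le> 2 * \<rho>" using that S by auto
    then have "V (z + a) \<le> K * V (z + a / 2)" "V (z + a / 2) \<le> K * V z"
      by (auto intro!: V_doubling simp: dist_norm norm_divide)
    then have "V (z + a) \<le> K * (K * V z)"
      using K_pos by (meson mult_left_mono less_imp_le order_trans)
    then show ?thesis by (simp add: power2_eq_square mult.assoc)
  qed
  have "emeasure \<nu> (ball z (real n * \<rho>)) \<le> ennreal (A ^ n * V z)" for n z
  proof (induction n arbitrary: z)
    case (Suc n)
    show ?case
    proof (cases "n = 0")
      case True
      have "1 * V z \<le> A * V z" using A V_pos[of z] by (intro mult_right_mono) auto
      then show ?thesis using True by (simp add: emeasure_V ennreal_leI)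
    next
      case False
      have sub: "ball z (real (Suc n) * \<rho>) \<subseteq> (\<Union>a\<in>S. ball (z + a) (real n * \<rho>))"
      proof
        fix x assume "x \<in> ball z (real (Suc n) * \<rho>)"
        then have x: "cmod (x - z) < real (Suc n) * \<rho>" by (simp add: dist_norm norm_minus_commute)
        \<comment> \<open>Scales the disk of radius (n+1) \<rho> down to radius 2 \<rho>, where the
          cover applies. A centre \<open>a\<close> approximates \<open>t * (x - z)\<close> up to
          \<rho>, and the rest of \<open>x - z\<close> has length at most (n-1) \<rho>, in total
          less than n \<rho>. The bound t \<le> 1 needs n \<ge> 1, hence the separate treatment of
          radius \<rho>.\<close>
        define t where "t = 2 / real (Suc n)"
        have t: "0 < t" "t \<le> 1" "t * real (Suc n) = 2" using False by (auto simp: t_def field_simps)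
        have "cmod (of_real t * (x - z)) \<le> t * (real (Suc n) * \<rho>)"
          unfolding norm_mult using t x by (intro mult_mono) auto
        then have "of_real t * (x - z) \<in> cball 0 (2 * \<rho>)"
          using t(3) by (simp add: mult.assoc[symmetric])
        then obtain a where a: "a \<in> S" "cmod (of_real t * (x - z) - a) < \<rho>"
          using S(3) by (force simp: dist_norm norm_minus_commute)
        have "cmod (of_real (1 - t) * (x - z)) \<le> (1 - t) * (real (Suc n) * \<rho>)"
          unfolding norm_mult norm_of_real using t x by (intro mult_mono) auto
        also have "\<dots> = (real (Suc n) - t * real (Suc n)) * \<rho>" by (simp add: algebra_simps)
        also have "\<dots> = (real n - 1) * \<rho>" using t(3) by simp
        finally have "cmod (of_real (1 - t) * (x - z)) \<le> (real n - 1) * \<rho>" .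
        moreover have eq: "x - (z + a) = of_real (1 - t) * (x - z) + (of_real t * (x - z) - a)"
          by (simp add: algebra_simps)
        ultimately have "cmod (x - (z + a)) < (real n - 1) * \<rho> + \<rho>"
          unfolding eq using a(2) norm_triangle_ineq[of "of_real (1 - t) * (x - z)" "of_real t * (x - z) - a"]
          by linarith
        then show "x \<in> (\<Union>a\<in>S. ball (z + a) (real n * \<rho>))"
          using a(1) by (auto simp: dist_norm norm_minus_commute algebra_simps)
      qed
      have "emeasure \<nu> (ball z (real (Suc n) * \<rho>)) \<le> emeasure \<nu> (\<Union>a\<in>S. ball (z + a) (real n * \<rho>))"
        by (rule emeasure_mono[OF sub]) (use S in auto)
      also have "\<dots> \<le> (\<Sum>a\<in>S. emeasure \<nu> (ball (z + a) (real n * \<rho>)))"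
        by (rule emeasure_subadditive_finite) (use S in auto)
      also have "\<dots> \<le> (\<Sum>a\<in>S. ennreal (A ^ n * (K\<^sup>2 * V z)))"
        using A by (intro sum_mono order_trans[OF Suc] ennreal_leI mult_left_mono VK) auto
      also have "\<dots> = ennreal (real (card S) * K\<^sup>2 * (A ^ n * V z))"
        using A V_pos[of z] less_imp_le[OF V_pos]
        by (simp add: ennreal_mult ennreal_of_nat_eq_real_of_nat mult_ac)
      also have "\<dots> \<le> ennreal (A * (A ^ n * V z))"
        using A V_pos[of z] by (intro ennreal_leI mult_right_mono) auto
      finally show ?thesis by (simp add: mult_ac)
    qed
  qed simp
  with A(1) show ?thesis by (rule that)
qed

text \<open>A multiple of the disk about \<open>z\<close> swallows the fixed disk about 0, and
  \<open>ball_growth\<close> controls the price. This turns point bounds weighted by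
  \<open>V\<close> into locally uniform ones.\<close>

lemma V_locally_bounded_below:
  obtains b where "0 < b" "\<And>z. cmod z \<le> R \<Longrightarrow> b \<le> V z"
proof -
  obtain A where A: "1 \<le> A" "\<And>n z. emeasure \<nu> (ball z (real n * \<rho>)) \<le> ennreal (A ^ n * V z)"
    using ball_growth by blast
  obtain n where n: "R / \<rho> + 1 \<le> real n" using real_arch_simple by blast
  have "V 0 / A ^ n \<le> V z" if z: "cmod z \<le> R" for z
  proof -
    have "R + \<rho> \<le> real n * \<rho>" using n \<rho>_pos by (simp add: field_simps)
    have sub: "ball 0 \<rho> \<subseteq> ball z (real n * \<rho>)"
    proof (intro subsetI)
      fix x :: complex assume "x \<in> ball 0 \<rho>"
      then show "x \<in> ball z (real n * \<rho>)"
        using z dist_triangle[of z x 0] \<open>R + \<rho> \<le> real n * \<rho>\<close> by simp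
    qed
    have "ennreal (V 0) \<le> emeasure \<nu> (ball z (real n * \<rho>))"
      unfolding emeasure_V[symmetric] by (rule emeasure_mono[OF sub]) simp
    also note A(2)
    finally have "V 0 \<le> A ^ n * V z" using A(1) less_imp_le[OF V_pos, of z] by simp
    then show ?thesis using A(1) by (simp add: field_simps)
  qed
  moreover have "0 < V 0 / A ^ n" using V_pos A(1) by simp
  ultimately show ?thesis using that by blast
qed

text \<open>The plane is cut into annuli of width \<rho>. Disk masses grow at most like A^n, while
  the Gaussian decays like exp(-\<alpha> \<rho>^2 n^2), so the sum converges with a value
  independent of \<open>z\<close>.\<close>

lemma gaussian_integral_bound:
  assumes "0 < \<alpha>"
  obtains C where "0 < C"
    "\<And>z. (\<integral>\<^sup>+x. ennreal (exp (- \<alpha> * (cmod (x - z))\<^sup>2)) \<partial>\<nu>) \<le> ennreal (C * V z)"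
proof -
  obtain A where A: "1 \<le> A" "\<And>n z. emeasure \<nu> (ball z (real n * \<rho>)) \<le> ennreal (A ^ n * V z)"
    using ball_growth by blast
  define q where "q n = exp (- \<alpha> * (real n * \<rho>)\<^sup>2)" for n :: nat
  define C where "C = (\<Sum>n. q n * A ^ Suc n)"
  have summ: "summable (\<lambda>n. q n * A ^ Suc n)"
  proof -
    \<comment> \<open>From this index on \<alpha> \<rho>^2 n \<ge> ln A + 1, so that
      \<open>q n * A ^ n\<close> is at most exp(-n).\<close>
    obtain N :: nat where N: "(ln A + 1) / (\<alpha> * \<rho>\<^sup>2) \<le> real N" using real_arch_simple by blast
    show ?thesis
    proof (rule summable_comparison_test)
      show "summable (\<lambda>n. A * exp (- 1) ^ n :: real)" by (intro summable_mult summable_geometric) auto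
      have "norm (q n * A ^ Suc n) \<le> A * exp (- 1) ^ n" if "n \<ge> N" for n
      proof -
        have "(ln A + 1) / (\<alpha> * \<rho>\<^sup>2) \<le> real n" using N that by linarith
        then have "ln A + 1 \<le> real n * (\<alpha> * \<rho>\<^sup>2)"
          using assms \<rho>_pos by (simp add: field_simps)
        then have "real n * (ln A + 1) \<le> real n * (real n * (\<alpha> * \<rho>\<^sup>2))"
          by (intro mult_left_mono) auto
        then have "- \<alpha> * (real n * \<rho>)\<^sup>2 + real n * ln A \<le> real n * (- 1)"
          by (simp add: algebra_simps power2_eq_square)
        then have "exp (- \<alpha> * (real n * \<rho>)\<^sup>2 + real n * ln A) \<le> exp (real n * (- 1))"
          by simp
        then have "q n * A ^ n \<le> exp (- 1) ^ n"
          unfolding exp_add exp_of_nat_mult using A by (simp add: q_def)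
        then have "A * (q n * A ^ n) \<le> A * exp (- 1) ^ n" using A by (intro mult_left_mono) auto
        then show ?thesis using A by (simp add: q_def mult_ac)
      qed
      then show "\<exists>N. \<forall>n\<ge>N. norm (q n * A ^ Suc n) \<le> A * exp (- 1) ^ n" by blast
    qed
  qed
  have qA: "0 < q n * A ^ Suc n" for n using A by (simp add: q_def)
  have "0 < C" unfolding C_def by (rule suminf_pos[OF summ qA])
  moreover have "(\<integral>\<^sup>+x. ennreal (exp (- \<alpha> * (cmod (x - z))\<^sup>2)) \<partial>\<nu>) \<le> ennreal (C * V z)" for z
  proof -
    have "(\<integral>\<^sup>+x. ennreal (exp (- \<alpha> * (cmod (x - z))\<^sup>2)) \<partial>\<nu>)
        \<le> (\<integral>\<^sup>+x. (\<Sum>n. ennreal (q n) * indicator (ball z (real (Suc n) * \<rho>)) x) \<partial>\<nu>)"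
    proof (rule nn_integral_mono)
      fix x
      \<comment> \<open>Index of the annulus n \<rho> \<le> |x - z| < (n+1) \<rho> that contains
        \<open>x\<close>; a single term of the series already dominates.\<close>
      define n where "n = nat \<lfloor>cmod (x - z) / \<rho>\<rfloor>"
      have "0 \<le> cmod (x - z) / \<rho>" using \<rho>_pos by simp
      then have n: "real n \<le> cmod (x - z) / \<rho>" "cmod (x - z) / \<rho> < real n + 1"
        unfolding n_def by linarith+
      have in_ball: "x \<in> ball z (real (Suc n) * \<rho>)"
        using n(2) \<rho>_pos by (simp add: field_simps dist_norm norm_minus_commute)
      have "real n * \<rho> \<le> cmod (x - z)" using n(1) \<rho>_pos by (simp add: field_simps)
      then have "(real n * \<rho>)\<^sup>2 \<le> (cmod (x - z))\<^sup>2" using \<rho>_pos by (intro power_mono) auto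
      then have "ennreal (exp (- \<alpha> * (cmod (x - z))\<^sup>2)) \<le> ennreal (q n)"
        using assms by (simp add: q_def)
      also have "\<dots> = (\<Sum>n\<in>{n}. ennreal (q n) * indicator (ball z (real (Suc n) * \<rho>)) x)"
        using in_ball by simp
      also have "\<dots> \<le> (\<Sum>n. ennreal (q n) * indicator (ball z (real (Suc n) * \<rho>)) x)"
        by (rule sum_le_suminf) auto
      finally show "ennreal (exp (- \<alpha> * (cmod (x - z))\<^sup>2))
        \<le> (\<Sum>n. ennreal (q n) * indicator (ball z (real (Suc n) * \<rho>)) x)" .
    qed
    also have "\<dots> = (\<Sum>n. \<integral>\<^sup>+x. ennreal (q n) * indicator (ball z (real (Suc n) * \<rho>)) x \<partial>\<nu>)"
      by (rule nn_integral_suminf) measurable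
    also have "\<dots> = (\<Sum>n. ennreal (q n) * emeasure \<nu> (ball z (real (Suc n) * \<rho>)))"
      by (simp add: nn_integral_cmult_indicator)
    also have "\<dots> \<le> (\<Sum>n. ennreal (q n) * ennreal (A ^ Suc n * V z))"
      by (intro suminf_le mult_left_mono A) auto
    also have "\<dots> = (\<Sum>n. ennreal (q n * A ^ Suc n * V z))"
      using A V_pos[of z] by (simp add: q_def ennreal_mult'[symmetric] mult.assoc)
    also have "\<dots> = ennreal (\<Sum>n. q n * A ^ Suc n * V z)"
      using qA V_pos[of z] by (intro suminf_ennreal2 summable_mult2 summ)
        (auto intro!: mult_nonneg_nonneg less_imp_le)
    also have "(\<Sum>n. q n * A ^ Suc n * V z) = C * V z"
      unfolding C_def by (rule suminf_mult2[OF summ, symmetric])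
    finally show ?thesis .
  qed
  ultimately show ?thesis using that by blast
qed

text \<open>Maximising \<open>|g(x)| (r - |x - z|)\<^sup>m\<close> yields a point \<open>y\<close> at distance \<open>2 d\<close> from the circle
  with \<open>|g(y)| \<ge> (r / 2 d)\<^sup>m |g(z)|\<close>. By Cauchy's estimate \<open>|g| \<ge> |g(y)| / 2\<close> on \<open>ball y (\<kappa> d)\<close>, and
  the factor \<open>(r / 2 d)\<^sup>m\<close> compensates for the small measure of that disk. This replaces
  subharmonicity of a small power of \<open>|g|\<close> followed by Hoelder's inequality.\<close>

lemma holomorphic_mean_value_bound:
  assumes r: "0 < r" "r \<le> \<rho>"
  obtains C where "0 < C"
    "\<And>g z. g holomorphic_on UNIV \<Longrightarrow>
      ennreal ((cmod (g z))\<^sup>2 * V z) \<le> ennreal C * (\<integral>\<^sup>+x\<in>ball z r. ennreal ((cmod (g x))\<^sup>2) \<partial>\<nu>)"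
proof -
  \<comment> \<open>Chosen so that on \<open>ball y (\<kappa> * d)\<close> the Lipschitz bound, with
    constant 2 * 2^m |g(y)| / d, allows \<open>g\<close> to vary by at most |g(y)| / 2.\<close>
  define \<kappa> where "\<kappa> = (1/4 :: real) * (1/2) ^ m"
  have \<kappa>: "0 < \<kappa>" "\<kappa> \<le> 1/4" "2 * 2 ^ m * \<kappa> = 1/2"
    by (auto simp: \<kappa>_def power_one_over mult_le_one)
  \<comment> \<open>One factor 4 is lost by halving |g(y)|, the factor 4^m comes from comparing g(z)
    with g(y), and \<open>c * \<kappa> ^ m\<close> comes from the mass of the small disk.\<close>
  define C where "C = 4 ^ (m + 1) / (c * \<kappa> ^ m * r ^ m)"
  have C: "0 < C" using c_pos \<kappa> r by (simp add: C_def)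
  have "ennreal ((cmod (g z))\<^sup>2 * V z) \<le> ennreal C * (\<integral>\<^sup>+x\<in>ball z r. ennreal ((cmod (g x))\<^sup>2) \<partial>\<nu>)"
    if hol: "g holomorphic_on UNIV" for g z
  proof (cases "g z = 0")
    case False
    define \<Phi> where "\<Phi> x = cmod (g x) * (r - cmod (x - z)) ^ m" for x
    have contg: "continuous_on S g" for S
      using hol holomorphic_on_imp_continuous_on continuous_on_subset by blast
    have "continuous_on (cball z r) \<Phi>"
      unfolding \<Phi>_def by (intro continuous_intros contg)
    then have "\<exists>y\<in>cball z r. \<forall>x\<in>cball z r. \<Phi> x \<le> \<Phi> y"
      using r by (intro continuous_attains_sup) auto
    then obtain y where y: "y \<in> cball z r" and max: "\<And>x. x \<in> cball z r \<Longrightarrow> \<Phi> x \<le> \<Phi> y"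
      by blast
    define d where "d = (r - cmod (y - z)) / 2"
    have d2: "2 * d = r - cmod (y - z)" by (simp add: d_def)
    have \<Phi>y: "cmod (g z) * r ^ m \<le> cmod (g y) * (2 * d) ^ m"
      using max[of z] r by (simp add: \<Phi>_def d2)
    have "0 < cmod (g y) * (2 * d) ^ m"
      using False r by (intro less_le_trans[OF _ \<Phi>y]) auto
    moreover have "0 \<le> d" using y by (simp add: d_def dist_norm norm_minus_commute)
    \<comment> \<open>A maximum on the circle would be zero because the exponent is positive; this
      is where \<open>m_pos\<close> enters.\<close>
    ultimately have d: "0 < d" using m_pos by (cases "d = 0") (auto simp: power_0_left)
    have dr: "2 * d \<le> r" by (simp add: d_def)
    have near: "cmod (x - z) \<le> r - d" if "x \<in> cball y d" for x
    proof -
      have "cmod (x - z) \<le> cmod (x - y) + cmod (y - z)"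
        using norm_triangle_ineq[of "x - y" "y - z"] by simp
      then show ?thesis using that by (simp add: dist_norm norm_minus_commute d_def field_simps)
    qed
    \<comment> \<open>The factor in \<Phi> is \<open>(2 * d) ^ m\<close> at \<open>y\<close> and at
      least \<open>d ^ m\<close> on this disk, so maximality lets |g| grow by at most 2^m.\<close>
    have upper: "cmod (g x) \<le> 2 ^ m * cmod (g y)" if x: "x \<in> cball y d" for x
    proof -
      have "cmod (g x) * d ^ m \<le> \<Phi> x"
        unfolding \<Phi>_def using near[OF x] d by (intro mult_left_mono power_mono) auto
      also have "\<dots> \<le> \<Phi> y" using near[OF x] d by (intro max) (simp add: dist_norm norm_minus_commute)
      also have "\<dots> = (2 ^ m * cmod (g y)) * d ^ m"
        by (simp add: \<Phi>_def d2[symmetric] power_mult_distrib mult_ac)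
      finally show ?thesis using d by simp
    qed
    have lower: "cmod (g y) / 2 \<le> cmod (g x)" if "x \<in> ball y (\<kappa> * d)" for x
    proof -
      have x: "cmod (x - y) < \<kappa> * d" using that by (simp add: dist_norm norm_minus_commute)
      have "\<kappa> * d \<le> 1/4 * d" using \<kappa> d by (intro mult_right_mono) auto
      then have "cmod (x - y) < d / 2" using x d by linarith
      then have "cmod (g x - g y) \<le> 2 * (2 ^ m * cmod (g y)) / d * cmod (x - y)"
        using d upper by (intro holomorphic_Lipschitz_bound[OF hol]) auto
      also have "\<dots> \<le> 2 * (2 ^ m * cmod (g y)) / d * (\<kappa> * d)"
        using x d by (intro mult_left_mono) auto
      also have "\<dots> = (2 * 2 ^ m * \<kappa>) * cmod (g y)" using d by simp
      finally have "cmod (g x - g y) \<le> cmod (g y) / 2" using \<kappa>(3) by simp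
      then show ?thesis using norm_triangle_ineq2[of "g y" "g x"] by (simp add: norm_minus_commute)
    qed
    have sub: "ball y (\<kappa> * d) \<subseteq> ball z r"
    proof
      fix x assume "x \<in> ball y (\<kappa> * d)"
      moreover have "\<kappa> * d \<le> 1 * d" using \<kappa> d by (intro mult_right_mono) auto
      ultimately have "x \<in> cball y d" by simp
      from near[OF this] d show "x \<in> ball z r" by (simp add: dist_norm norm_minus_commute)
    qed
    have "ennreal (c * (\<kappa> * d) ^ m * V z) \<le> emeasure \<nu> (ball y (\<kappa> * d))"
      using \<kappa> d sub r by (intro ball_lower) auto
    then have "ennreal ((cmod (g y))\<^sup>2 / 4) * ennreal (c * (\<kappa> * d) ^ m * V z)
        \<le> ennreal ((cmod (g y))\<^sup>2 / 4) * emeasure \<nu> (ball y (\<kappa> * d))"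
      by (rule mult_left_mono) simp
    also have "\<dots> = (\<integral>\<^sup>+x. ennreal ((cmod (g y))\<^sup>2 / 4) * indicator (ball y (\<kappa> * d)) x \<partial>\<nu>)"
      by (simp add: nn_integral_cmult_indicator)
    also have "\<dots> \<le> (\<integral>\<^sup>+x\<in>ball z r. ennreal ((cmod (g x))\<^sup>2) \<partial>\<nu>)"
    proof (rule nn_integral_mono)
      fix x
      show "ennreal ((cmod (g y))\<^sup>2 / 4) * indicator (ball y (\<kappa> * d)) x
          \<le> ennreal ((cmod (g x))\<^sup>2) * indicator (ball z r) x"
      proof (cases "x \<in> ball y (\<kappa> * d)")
        case True
        have "(cmod (g y) / 2)\<^sup>2 \<le> (cmod (g x))\<^sup>2" using lower[OF True] by (intro power_mono) auto
        then have "ennreal ((cmod (g y))\<^sup>2 / 4) \<le> ennreal ((cmod (g x))\<^sup>2)"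
          by (intro ennreal_leI) (simp add: power_divide)
        then show ?thesis using True sub by auto
      qed simp
    qed
    finally have int: "ennreal ((cmod (g y))\<^sup>2 / 4 * (c * (\<kappa> * d) ^ m * V z))
        \<le> (\<integral>\<^sup>+x\<in>ball z r. ennreal ((cmod (g x))\<^sup>2) \<partial>\<nu>)"
      by (subst ennreal_mult') auto
    \<comment> \<open>Squaring produces the power 2m of \<open>2 * d\<close>. Half of it is traded
      for \<open>r ^ m\<close>, leaving exactly the \<open>d ^ m\<close> that the mass of the small
      disk provides.\<close>
    have "(cmod (g z) * r ^ m)\<^sup>2 \<le> (cmod (g y) * (2 * d) ^ m)\<^sup>2"
      using \<Phi>y r by (intro power_mono) auto
    also have "\<dots> = (cmod (g y))\<^sup>2 * (2 ^ m * d ^ m) * (2 * d) ^ m"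
      by (simp add: power2_eq_square power_mult_distrib mult_ac)
    also have "\<dots> \<le> (cmod (g y))\<^sup>2 * (2 ^ m * d ^ m) * r ^ m"
      using dr d by (intro mult_left_mono power_mono) auto
    also have "\<dots> \<le> (cmod (g y))\<^sup>2 * (4 ^ m * d ^ m) * r ^ m"
      using r d by (intro mult_left_mono mult_right_mono power_mono) auto
    finally have "((cmod (g z))\<^sup>2 * r ^ m) * r ^ m \<le> ((cmod (g y))\<^sup>2 * (4 ^ m * d ^ m)) * r ^ m"
      by (simp add: power2_eq_square mult_ac)
    then have gz: "(cmod (g z))\<^sup>2 * r ^ m \<le> (cmod (g y))\<^sup>2 * (4 ^ m * d ^ m)"
      using r by simp
    have "(cmod (g z))\<^sup>2 * V z = ((cmod (g z))\<^sup>2 * r ^ m) * (V z / r ^ m)" using r by simp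
    also have "\<dots> \<le> ((cmod (g y))\<^sup>2 * (4 ^ m * d ^ m)) * (V z / r ^ m)"
      using gz r V_pos[of z] by (intro mult_right_mono) auto
    also have "\<dots> = C * ((cmod (g y))\<^sup>2 / 4 * (c * (\<kappa> * d) ^ m * V z))"
      using c_pos \<kappa> r by (simp add: C_def power_mult_distrib field_simps)
    finally have "ennreal ((cmod (g z))\<^sup>2 * V z)
        \<le> ennreal (C * ((cmod (g y))\<^sup>2 / 4 * (c * (\<kappa> * d) ^ m * V z)))"
      by (rule ennreal_leI)
    also have "\<dots> = ennreal C * ennreal ((cmod (g y))\<^sup>2 / 4 * (c * (\<kappa> * d) ^ m * V z))"
      by (rule ennreal_mult') (use C in simp)
    also have "\<dots> \<le> ennreal C * (\<integral>\<^sup>+x\<in>ball z r. ennreal ((cmod (g x))\<^sup>2) \<partial>\<nu>)"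
      by (intro mult_left_mono int) simp
    finally show ?thesis .
  qed simp
  with C show ?thesis using that by blast
qed

end

section \<open>Kernel estimates and Carleson embedding\<close>

text \<open>Disks about a countable dense set of centres cover the plane. For \<mu> the
  sigma-finiteness needed in Tonelli's theorem is not given, but it follows in this way from bounded
  averages.\<close>

lemma sigma_finite_if_balls_finite:
  fixes N :: "complex measure"
  assumes N: "sets N = sets borel" and r: "0 < r" and fin: "\<And>z. emeasure N (ball z r) < \<infinity>"
  shows "sigma_finite_measure N"
proof
  obtain D :: "complex set" where D: "countable D" "closure D = UNIV"
    using separable[of "UNIV :: complex set"] by (metis top.extremum_unique)
  show "\<exists>A. countable A \<and> A \<subseteq> sets N \<and> \<Union>A = space N \<and> (\<forall>a\<in>A. emeasure N a \<noteq> \<infinity>)"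
  proof (intro exI[of _ "(\<lambda>z. ball z r) ` D"] conjI)
    have "\<exists>z\<in>D. x \<in> ball z r" for x
      using D(2) r closure_approachable[of x D] by auto
    then show "\<Union>((\<lambda>z. ball z r) ` D) = space N"
      using sets_eq_imp_space_eq[OF N] by auto
    show "\<forall>a\<in>(\<lambda>z. ball z r) ` D. emeasure N a \<noteq> \<infinity>"
      using fin by (auto simp: less_top[symmetric])
  qed (use D N in auto)
qed

locale weighted_fock = doubling_measure +
  fixes \<alpha> :: real
  assumes \<alpha>_pos: "0 < \<alpha>"
begin

section \<open>The Gaussian factor and point evaluation bounds\<close>

definition gauss :: "complex \<Rightarrow> real" where "gauss z = exp (- \<alpha> * (cmod z)\<^sup>2)"

lemma gauss_pos [simp]: "0 < gauss z" "0 \<le> gauss z"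
  by (auto simp: gauss_def)

lemma gauss_measurable [measurable]: "gauss \<in> borel_measurable borel"
  unfolding gauss_def by measurable

definition M :: "complex measure" where "M = density \<nu> (\<lambda>z. ennreal (gauss z))"

lemma sets_M [measurable_cong, simp]: "sets M = sets borel"
  by (simp add: M_def)

text \<open>Up to a constant factor, the reciprocal of the normalised kernel of the unweighted Fock
  space. As an entire function it can multiply \<open>f\<close> without destroying holomorphy, and
  near \<open>z\<close> its squared modulus is comparable to the Gaussian factor, uniformly in
  \<open>z\<close>.\<close>

definition twist :: "complex \<Rightarrow> complex \<Rightarrow> complex" where
  "twist z x = exp (of_real (\<alpha> * (cmod z)\<^sup>2 / 2) - of_real \<alpha> * cnj z * x)"

lemma twist_holomorphic: "twist z holomorphic_on UNIV"
  unfolding twist_def by (intro holomorphic_intros)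

lemma cmod_twist_squared: "(cmod (twist z x))\<^sup>2 = gauss x * exp (\<alpha> * (cmod (x - z))\<^sup>2)"
proof -
  have "(cmod (twist z x))\<^sup>2 = exp (2 * Re (of_real (\<alpha> * (cmod z)\<^sup>2 / 2) - of_real \<alpha> * cnj z * x))"
    unfolding twist_def norm_exp_eq_Re exp_double ..
  also have "2 * Re (of_real (\<alpha> * (cmod z)\<^sup>2 / 2) - of_real \<alpha> * cnj z * x)
      = - \<alpha> * (cmod x)\<^sup>2 + \<alpha> * (cmod (x - z))\<^sup>2"
    unfolding cmod_power2 by (simp add: algebra_simps power2_eq_square)
  finally show ?thesis by (simp only: gauss_def exp_add)
qed

lemma cmod_mult_twist_squared:
  "(cmod (f x * twist z x))\<^sup>2 = (cmod (f x))\<^sup>2 * gauss x * exp (\<alpha> * (cmod (x - z))\<^sup>2)"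
  by (simp add: norm_mult power_mult_distrib cmod_twist_squared)

text \<open>The mean value bound is applied to \<open>f\<close> times \<open>twist z\<close>. The
  squared modulus of this product is |f|^2 times the Gaussian, up to a factor that is 1 at
  \<open>z\<close> and at most \<open>exp (\<alpha> * r\<^sup>2)\<close> on the disk.\<close>

lemma entire_local_bound:
  assumes r: "0 < r" "r \<le> \<rho>"
  obtains C where "0 < C"
    "\<And>f z. f holomorphic_on UNIV \<Longrightarrow> ennreal ((cmod (f z))\<^sup>2 * gauss z * V z)
       \<le> ennreal C * (\<integral>\<^sup>+x\<in>ball z r. ennreal ((cmod (f x))\<^sup>2 * gauss x) \<partial>\<nu>)"
proof -
  obtain C where C: "0 < C" "\<And>g z. g holomorphic_on UNIV \<Longrightarrow>
      ennreal ((cmod (g z))\<^sup>2 * V z) \<le> ennreal C * (\<integral>\<^sup>+x\<in>ball z r. ennreal ((cmod (g x))\<^sup>2) \<partial>\<nu>)"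
    using holomorphic_mean_value_bound[OF r] by blast
  define C' where "C' = C * exp (\<alpha> * r\<^sup>2)"
  have "ennreal ((cmod (f z))\<^sup>2 * gauss z * V z)
       \<le> ennreal C' * (\<integral>\<^sup>+x\<in>ball z r. ennreal ((cmod (f x))\<^sup>2 * gauss x) \<partial>\<nu>)"
    if f: "f holomorphic_on UNIV" for f z
  proof -
    have [measurable]: "f \<in> borel_measurable borel" by (rule entire_borel_measurable[OF f])
    have "ennreal ((cmod (f z))\<^sup>2 * gauss z * V z) = ennreal ((cmod (f z * twist z z))\<^sup>2 * V z)"
      by (simp add: cmod_mult_twist_squared)
    also have "\<dots> \<le> ennreal C * (\<integral>\<^sup>+x\<in>ball z r. ennreal ((cmod (f x * twist z x))\<^sup>2) \<partial>\<nu>)"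
      by (intro C holomorphic_on_mult f twist_holomorphic)
    also have "(\<integral>\<^sup>+x\<in>ball z r. ennreal ((cmod (f x * twist z x))\<^sup>2) \<partial>\<nu>)
        \<le> (\<integral>\<^sup>+x. ennreal (exp (\<alpha> * r\<^sup>2)) * (ennreal ((cmod (f x))\<^sup>2 * gauss x) * indicator (ball z r) x) \<partial>\<nu>)"
    proof (rule nn_integral_mono)
      fix x
      show "ennreal ((cmod (f x * twist z x))\<^sup>2) * indicator (ball z r) x
        \<le> ennreal (exp (\<alpha> * r\<^sup>2)) * (ennreal ((cmod (f x))\<^sup>2 * gauss x) * indicator (ball z r) x)"
      proof (cases "x \<in> ball z r")
        case True
        then have "(cmod (x - z))\<^sup>2 \<le> r\<^sup>2"
          by (intro power_mono) (auto simp: dist_norm norm_minus_commute)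
        then have "exp (\<alpha> * (cmod (x - z))\<^sup>2) \<le> exp (\<alpha> * r\<^sup>2)" using \<alpha>_pos by simp
        then have "(cmod (f x))\<^sup>2 * gauss x * exp (\<alpha> * (cmod (x - z))\<^sup>2)
            \<le> (cmod (f x))\<^sup>2 * gauss x * exp (\<alpha> * r\<^sup>2)"
          by (intro mult_left_mono) auto
        then show ?thesis
          using True by (simp add: cmod_mult_twist_squared ennreal_mult'[symmetric] mult_ac)
      qed simp
    qed
    also have "\<dots> = ennreal (exp (\<alpha> * r\<^sup>2)) * (\<integral>\<^sup>+x\<in>ball z r. ennreal ((cmod (f x))\<^sup>2 * gauss x) \<partial>\<nu>)"
      by (rule nn_integral_cmult) measurable
    finally show ?thesis
      using C(1) by (simp add: C'_def ennreal_mult mult.assoc mult_left_mono)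
  qed
  moreover have "0 < C'" using C by (simp add: C'_def)
  ultimately show ?thesis using that by blast
qed

lemma nn_integral_M:
  "h \<in> borel_measurable borel \<Longrightarrow> (\<integral>\<^sup>+x. ennreal (h x) \<partial>M) = (\<integral>\<^sup>+x. ennreal (h x * gauss x) \<partial>\<nu>)"
  unfolding M_def by (subst nn_integral_density) (auto simp: ennreal_mult''[symmetric] mult.commute)

lemma entire_point_bound:
  obtains C where "0 < C"
    "\<And>f z. f \<in> entire_L2 M \<Longrightarrow>
       (cmod (f z))\<^sup>2 * gauss z * V z \<le> C * (\<integral>x. (cmod (f x))\<^sup>2 \<partial>M)"
proof -
  obtain C where C: "0 < C" "\<And>f z. f holomorphic_on UNIV \<Longrightarrow>
      ennreal ((cmod (f z))\<^sup>2 * gauss z * V z)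
       \<le> ennreal C * (\<integral>\<^sup>+x\<in>ball z \<rho>. ennreal ((cmod (f x))\<^sup>2 * gauss x) \<partial>\<nu>)"
    using entire_local_bound[OF \<rho>_pos order_refl] by blast
  have "(cmod (f z))\<^sup>2 * gauss z * V z \<le> C * (\<integral>x. (cmod (f x))\<^sup>2 \<partial>M)"
    if f: "f \<in> entire_L2 M" for f z
  proof -
    have hol: "f holomorphic_on UNIV" and int: "integrable M (\<lambda>x. (cmod (f x))\<^sup>2)"
      using f by (auto simp: entire_L2_def)
    have [measurable]: "f \<in> borel_measurable borel" by (rule entire_borel_measurable[OF hol])
    have "ennreal ((cmod (f z))\<^sup>2 * gauss z * V z)
       \<le> ennreal C * (\<integral>\<^sup>+x\<in>ball z \<rho>. ennreal ((cmod (f x))\<^sup>2 * gauss x) \<partial>\<nu>)"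
      by (rule C(2)[OF hol])
    also have "\<dots> \<le> ennreal C * (\<integral>\<^sup>+x. ennreal ((cmod (f x))\<^sup>2 * gauss x) \<partial>\<nu>)"
      by (intro mult_left_mono nn_integral_mono) (auto simp: indicator_def)
    also have "\<dots> = ennreal C * ennreal (\<integral>x. (cmod (f x))\<^sup>2 \<partial>M)"
      using nn_integral_eq_integral[OF int] by (simp add: nn_integral_M)
    also have "\<dots> = ennreal (C * (\<integral>x. (cmod (f x))\<^sup>2 \<partial>M))"
      using C(1) by (simp add: ennreal_mult)
    finally show ?thesis using C(1) by (subst (asm) ennreal_le_iff) auto
  qed
  with C(1) show ?thesis by (rule that)
qed

sublocale entire_L2_space M
proof
  show "\<exists>C. \<forall>f\<in>entire_L2 M. \<forall>z\<in>cball 0 R. (cmod (f z))\<^sup>2 \<le> C * (\<integral>x. (cmod (f x))\<^sup>2 \<partial>M)" for R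
  proof -
    obtain C where C: "0 < C" "\<And>f z. f \<in> entire_L2 M \<Longrightarrow>
       (cmod (f z))\<^sup>2 * gauss z * V z \<le> C * (\<integral>x. (cmod (f x))\<^sup>2 \<partial>M)"
      using entire_point_bound by blast
    obtain b where b: "0 < b" "\<And>z. cmod z \<le> R \<Longrightarrow> b \<le> V z"
      using V_locally_bounded_below by blast
    have "(cmod (f z))\<^sup>2 \<le> C * exp (\<alpha> * R\<^sup>2) / b * (\<integral>x. (cmod (f x))\<^sup>2 \<partial>M)"
      if f: "f \<in> entire_L2 M" and z: "z \<in> cball 0 R" for f z
    proof -
      have "(cmod z)\<^sup>2 \<le> R\<^sup>2" using z by (intro power_mono) auto
      then have "exp (- \<alpha> * R\<^sup>2) \<le> gauss z" using \<alpha>_pos by (simp add: gauss_def)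
      then have "(cmod (f z))\<^sup>2 * exp (- \<alpha> * R\<^sup>2) * b \<le> (cmod (f z))\<^sup>2 * gauss z * V z"
        using b z by (intro mult_mono mult_left_mono) auto
      also note C(2)[OF f]
      finally show ?thesis using b(1) by (simp add: exp_minus field_simps)
    qed
    then show ?thesis by blast
  qed
qed simp

text \<open>The upper bound is the point evaluation bound for the kernel itself at \<open>z\<close>,
  divided by the squared norm. The lower bound needs one test function with small norm and large
  value at \<open>z\<close>.\<close>

lemma kernel_norm_bounds:
  obtains D where "0 < D"
    "\<And>z. sqn (kernel z) * V z * gauss z \<le> D" "\<And>z. 1 \<le> D * V z * sqn (kernel z) * gauss z"
proof -
  obtain C where C: "0 < C" "\<And>f z. f \<in> H \<Longrightarrow> (cmod (f z))\<^sup>2 * gauss z * V z \<le> C * sqn f"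
    using entire_point_bound unfolding sqn_def by blast
  obtain C' where C': "0 < C'"
    "\<And>z. (\<integral>\<^sup>+x. ennreal (exp (- \<alpha> * (cmod (x - z))\<^sup>2)) \<partial>\<nu>) \<le> ennreal (C' * V z)"
    using gaussian_integral_bound[OF \<alpha>_pos] by blast
  have upper: "sqn (kernel z) * V z * gauss z \<le> C" for z
  proof (cases "sqn (kernel z) = 0")
    case False
    have "sqn (kernel z) * (sqn (kernel z) * V z * gauss z) \<le> sqn (kernel z) * C"
      using C(2)[OF kernel_in_H, of z z] by (simp add: kernel_diag power2_eq_square mult_ac)
    then show ?thesis using False sqn_nonneg[of "kernel z"] by (simp add: mult_le_cancel_left)
  qed (use C in simp)
  have lower: "1 \<le> C' * V z * sqn (kernel z) * gauss z" for z
  proof -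
    \<comment> \<open>The reciprocal of \<open>twist z\<close>. Its weighted squared modulus is the
      Gaussian centred at \<open>z\<close>, whose integral is controlled by
      \<open>V z\<close>.\<close>
    define f where "f x = exp (of_real \<alpha> * cnj z * x - of_real (\<alpha> * (cmod z)\<^sup>2 / 2))" for x
    have hol: "f holomorphic_on UNIV" unfolding f_def by (intro holomorphic_intros)
    have [measurable]: "f \<in> borel_measurable borel" by (rule entire_borel_measurable[OF hol])
    have f_twist: "f x * twist z x = 1" for x
      unfolding f_def twist_def exp_add[symmetric] by simp
    have f2: "(cmod (f x))\<^sup>2 * gauss x = exp (- \<alpha> * (cmod (x - z))\<^sup>2)" for x
      using cmod_mult_twist_squared[of f x z] unfolding f_twist
      by (simp add: exp_minus field_simps)
    have nn: "(\<integral>\<^sup>+x. ennreal ((cmod (f x))\<^sup>2) \<partial>M) \<le> ennreal (C' * V z)"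
    proof -
      have "(\<integral>\<^sup>+x. ennreal ((cmod (f x))\<^sup>2) \<partial>M) = (\<integral>\<^sup>+x. ennreal ((cmod (f x))\<^sup>2 * gauss x) \<partial>\<nu>)"
        by (rule nn_integral_M) measurable
      then show ?thesis unfolding f2 using C'(2)[of z] by simp
    qed
    have int: "integrable M (\<lambda>x. (cmod (f x))\<^sup>2)"
    proof (rule integrableI_bounded)
      show "(\<integral>\<^sup>+x. ennreal (norm ((cmod (f x))\<^sup>2)) \<partial>M) < \<infinity>"
        using le_less_trans[OF nn ennreal_less_top] by simp
    qed measurable
    have fH: "f \<in> H" using hol int by (simp add: entire_L2_def)
    have "sqn f \<le> C' * V z"
    proof -
      have "ennreal (sqn f) \<le> ennreal (C' * V z)"
        using nn nn_integral_eq_integral[OF int] by (simp add: sqn_def)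
      moreover have "0 \<le> C' * V z" using C'(1) V_pos[of z] by simp
      ultimately show ?thesis by simp
    qed
    have "(cmod (f z))\<^sup>2 \<le> (sqrt (sqn f) * sqrt (sqn (kernel z)))\<^sup>2"
      by (intro power_mono point_le_kernel fH) simp
    also have "\<dots> = sqn f * sqn (kernel z)" by (simp add: power_mult_distrib)
    also have "\<dots> \<le> C' * V z * sqn (kernel z)"
      using \<open>sqn f \<le> C' * V z\<close> by (intro mult_right_mono) auto
    finally have "(cmod (f z))\<^sup>2 * gauss z \<le> C' * V z * sqn (kernel z) * gauss z"
      by (intro mult_right_mono) auto
    then show ?thesis by (simp add: f2)
  qed
  show ?thesis
  proof (rule that[of "max C C'"])
    show "0 < max C C'" using C by simp
    show "sqn (kernel z) * V z * gauss z \<le> max C C'" for z using upper[of z] by simp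
    have "C' * (V z * sqn (kernel z) * gauss z) \<le> max C C' * (V z * sqn (kernel z) * gauss z)" for z
      using V_pos[of z] by (intro mult_right_mono) auto
    then show "1 \<le> max C C' * V z * sqn (kernel z) * gauss z" for z
      using order_trans[OF lower[of z]] by (simp add: mult.assoc)
  qed
qed

text \<open>After twisting, the kernel is an entire function whose value at \<open>z\<close> is
  comparable to its maximum on \<open>cball z \<rho>\<close>. A Lipschitz estimate then keeps at
  least half of that value within a distance independent of \<open>z\<close>.\<close>

lemma kernel_near_diagonal:
  obtains \<delta> \<eta> where "0 < \<delta>" "0 < \<eta>"
    "\<And>z x. cmod (x - z) < \<delta> \<Longrightarrow> \<eta> * sqn (kernel z) \<le> V z * ((cmod (kernel z x))\<^sup>2 * gauss x)"
proof -
  obtain C where C: "0 < C" "\<And>f z. f \<in> H \<Longrightarrow> (cmod (f z))\<^sup>2 * gauss z * V z \<le> C * sqn f"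
    using entire_point_bound unfolding sqn_def by blast
  obtain D where D: "0 < D" "\<And>z. sqn (kernel z) * V z * gauss z \<le> D"
    "\<And>z. 1 \<le> D * V z * sqn (kernel z) * gauss z"
    by (rule kernel_norm_bounds) (rule that)
  define C1 where "C1 = C * K * exp (\<alpha> * \<rho>\<^sup>2)"
  have C1: "0 < C1" using C K_pos by (simp add: C1_def)
  \<comment> \<open>The first bound makes the Lipschitz estimate applicable; the second makes the
    variation at most \<open>sqrt (S / D) / 2\<close>, half of the lower bound at the
    centre.\<close>
  define \<delta> where "\<delta> = min (\<rho> / 2) (\<rho> / (4 * sqrt (C1 * D)))"
  have \<delta>: "0 < \<delta>" using \<rho>_pos C1 D by (simp add: \<delta>_def)
  \<comment> \<open>The 4 comes from squaring one half, \<open>D\<close> from the lower bound at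
    \<open>z\<close>, and the exponential from undoing the twist.\<close>
  define \<eta> where "\<eta> = exp (- \<alpha> * \<delta>\<^sup>2) / (4 * D)"
  have \<eta>: "0 < \<eta>" using D by (simp add: \<eta>_def)
  have "\<eta> * sqn (kernel z) \<le> V z * ((cmod (kernel z x))\<^sup>2 * gauss x)"
    if x: "cmod (x - z) < \<delta>" for z x
  proof -
    define k where "k = kernel z"
    have kH: "k \<in> H" unfolding k_def by (rule kernel_in_H)
    \<comment> \<open>Common scale of the upper and lower bounds for the squared modulus of
      \<open>g\<close>; it cancels from their ratio, so \<delta> does not depend on
      \<open>z\<close>.\<close>
    define S where "S = sqn k / V z"
    have S: "0 \<le> S" using V_pos[of z] by (simp add: S_def)
    define g where "g x = k x * twist z x" for x
    have hol: "g holomorphic_on UNIV"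
      unfolding g_def by (intro holomorphic_on_mult H_hol kH twist_holomorphic)
    have gB: "cmod (g y) \<le> sqrt (C1 * S)" if y: "y \<in> cball z \<rho>" for y
    proof (rule real_le_rsqrt)
      have "(cmod (k y))\<^sup>2 * gauss y * V z \<le> (cmod (k y))\<^sup>2 * gauss y * (K * V y)"
        using y by (intro mult_left_mono V_doubling) auto
      also have "\<dots> = K * ((cmod (k y))\<^sup>2 * gauss y * V y)" by simp
      also have "\<dots> \<le> K * (C * sqn k)"
        using K_pos by (intro mult_left_mono C(2) kH) auto
      finally have *: "(cmod (k y))\<^sup>2 * gauss y \<le> C * K * S"
        using V_pos[of z] by (simp add: S_def field_simps)
      have "(cmod (y - z))\<^sup>2 \<le> \<rho>\<^sup>2"
        using y by (intro power_mono) (auto simp: dist_norm norm_minus_commute)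
      then have "exp (\<alpha> * (cmod (y - z))\<^sup>2) \<le> exp (\<alpha> * \<rho>\<^sup>2)" using \<alpha>_pos by simp
      then have "(cmod (k y))\<^sup>2 * gauss y * exp (\<alpha> * (cmod (y - z))\<^sup>2) \<le> C * K * S * exp (\<alpha> * \<rho>\<^sup>2)"
        using C(1) K_pos S by (intro mult_mono *) auto
      then show "(cmod (g y))\<^sup>2 \<le> C1 * S"
        by (simp add: g_def cmod_mult_twist_squared C1_def mult_ac)
    qed
    have "sqrt (S / D) \<le> cmod (g z)"
    proof (rule real_le_lsqrt)
      have "S / D = (1 / (D * V z)) * sqn k" by (simp add: S_def)
      also have "\<dots> \<le> (sqn k * gauss z) * sqn k"
        using D(1) D(3)[of z] V_pos[of z] by (intro mult_right_mono) (simp_all add: k_def field_simps)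
      also have "\<dots> = (cmod (g z))\<^sup>2"
        unfolding g_def cmod_mult_twist_squared by (simp add: k_def kernel_diag power2_eq_square)
      finally show "S / D \<le> (cmod (g z))\<^sup>2" .
    qed simp
    moreover have "cmod (g x - g z) \<le> sqrt (S / D) / 2"
    proof -
      have "cmod (g x - g z) \<le> 2 * sqrt (C1 * S) / \<rho> * cmod (x - z)"
        using x by (intro holomorphic_Lipschitz_bound[OF hol \<rho>_pos gB]) (auto simp: \<delta>_def)
      also have "\<dots> \<le> 2 * sqrt (C1 * S) / \<rho> * (\<rho> / (4 * sqrt (C1 * D)))"
        using x C1 S \<rho>_pos by (intro mult_left_mono) (auto simp: \<delta>_def)
      also have "\<dots> = sqrt (S / D) / 2"
        using C1 D(1) \<rho>_pos by (simp add: real_sqrt_mult real_sqrt_divide)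
      finally show ?thesis .
    qed
    ultimately have "sqrt (S / D) / 2 \<le> cmod (g x)"
      using norm_triangle_ineq2[of "g z" "g x"] by (simp add: norm_minus_commute)
    then have "(sqrt (S / D) / 2)\<^sup>2 \<le> (cmod (g x))\<^sup>2"
      using S D(1) by (intro power_mono) auto
    then have g: "S / (4 * D) \<le> (cmod (g x))\<^sup>2"
      using S D(1) by (simp add: power_divide mult.commute)
    have "(cmod (x - z))\<^sup>2 \<le> \<delta>\<^sup>2" using x by (intro power_mono) auto
    then have "exp (- \<alpha> * \<delta>\<^sup>2) \<le> exp (- \<alpha> * (cmod (x - z))\<^sup>2)" using \<alpha>_pos by simp
    then have "S / (4 * D) * exp (- \<alpha> * \<delta>\<^sup>2) \<le> (cmod (g x))\<^sup>2 * exp (- \<alpha> * (cmod (x - z))\<^sup>2)"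
      by (intro mult_mono g) auto
    also have "\<dots> = (cmod (k x))\<^sup>2 * gauss x"
      unfolding g_def cmod_mult_twist_squared by (simp add: exp_minus)
    finally have "V z * (S / (4 * D) * exp (- \<alpha> * \<delta>\<^sup>2)) \<le> V z * ((cmod (k x))\<^sup>2 * gauss x)"
      using V_pos[of z] by (intro mult_left_mono) auto
    also have "V z * (S / (4 * D) * exp (- \<alpha> * \<delta>\<^sup>2)) = \<eta> * sqn k"
      using V_pos[of z] by (simp add: S_def \<eta>_def)
    finally show ?thesis by (simp add: k_def)
  qed
  with \<delta> \<eta> show ?thesis by (rule that)
qed

section \<open>Averages, Berezin transform and Carleson measures\<close>

lemma ball_lower_V:
  assumes "0 < r" "r \<le> \<rho>"
  shows "ennreal (V z) \<le> ennreal (1 / (c * r ^ m)) * emeasure \<nu> (ball z r)"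
proof -
  have "ennreal (V z) = ennreal (1 / (c * r ^ m)) * ennreal (c * r ^ m * V z)"
    using assms c_pos by (subst ennreal_mult'[symmetric]) auto
  also have "\<dots> \<le> ennreal (1 / (c * r ^ m)) * emeasure \<nu> (ball z r)"
    using assms by (intro mult_left_mono ball_lower) auto
  finally show ?thesis .
qed

text \<open>By the estimate near the diagonal the Berezin integrand is at least \<eta> / V(z) on
  \<open>ball z r\<close>, so this disk alone contributes enough. The constant depends on
  \<open>r\<close>, but on neither \<mu> nor \<open>z\<close>.\<close>

lemma average_le_berezin:
  obtains \<delta> where "0 < \<delta>" "\<And>r. 0 < r \<Longrightarrow> r < \<delta> \<Longrightarrow> \<exists>C>0. \<forall>\<mu> z. sets \<mu> = sets borel \<longrightarrow>
    emeasure \<mu> (ball z r) / emeasure \<nu> (ball z r) \<le> ennreal C *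
      (\<integral>\<^sup>+x. ennreal ((cmod (kernel z x / of_real (sqrt (sqn (kernel z)))))\<^sup>2 * gauss x) \<partial>\<mu>)"
proof -
  obtain \<delta> \<eta> where \<delta>: "0 < \<delta>" and \<eta>: "0 < \<eta>" and near:
    "\<And>z x. cmod (x - z) < \<delta> \<Longrightarrow> \<eta> * sqn (kernel z) \<le> V z * ((cmod (kernel z x))\<^sup>2 * gauss x)"
    by (rule kernel_near_diagonal) (rule that)
  obtain D where D: "0 < D" "\<And>z. sqn (kernel z) * V z * gauss z \<le> D"
    "\<And>z. 1 \<le> D * V z * sqn (kernel z) * gauss z"
    by (rule kernel_norm_bounds) (rule that)
  have kpos: "0 < sqn (kernel z)" for z
    using D(3)[of z] by (cases "sqn (kernel z) = 0") (auto simp: order.strict_iff_order)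
  have "\<exists>C>0. \<forall>\<mu> z. sets \<mu> = sets borel \<longrightarrow>
    emeasure \<mu> (ball z r) / emeasure \<nu> (ball z r) \<le> ennreal C *
      (\<integral>\<^sup>+x. ennreal ((cmod (kernel z x / of_real (sqrt (sqn (kernel z)))))\<^sup>2 * gauss x) \<partial>\<mu>)"
    if r: "0 < r" "r < min \<rho> \<delta>" for r
  proof (intro exI[of _ "1 / \<eta> * (1 / (c * r ^ m))"] conjI allI impI)
    show "0 < 1 / \<eta> * (1 / (c * r ^ m))" using \<eta> c_pos r by simp
    fix \<mu> :: "complex measure" and z
    assume [measurable_cong]: "sets \<mu> = sets borel"
    define b where "b x = (cmod (kernel z x / of_real (sqrt (sqn (kernel z)))))\<^sup>2 * gauss x" for x
    define I where "I = (\<integral>\<^sup>+x. ennreal (b x) \<partial>\<mu>)"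
    have [measurable]: "kernel z \<in> borel_measurable borel" by (intro H_meas kernel_in_H)
    have low: "\<eta> / V z \<le> b x" if "x \<in> ball z r" for x
    proof -
      have "\<eta> * sqn (kernel z) \<le> V z * ((cmod (kernel z x))\<^sup>2 * gauss x)"
        using that r by (intro near) (auto simp: dist_norm norm_minus_commute)
      then have "\<eta> / V z \<le> (cmod (kernel z x))\<^sup>2 * gauss x / sqn (kernel z)"
        using kpos[of z] V_pos[of z] by (simp add: field_simps)
      also have "\<dots> = b x"
        by (simp add: b_def norm_divide power_divide)
      finally show ?thesis .
    qed
    have "ennreal (\<eta> / V z) * emeasure \<mu> (ball z r) = (\<integral>\<^sup>+x. ennreal (\<eta> / V z) * indicator (ball z r) x \<partial>\<mu>)"
      by (subst nn_integral_cmult_indicator) auto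
    also have "\<dots> \<le> I"
      unfolding I_def by (intro nn_integral_mono) (auto simp: indicator_def low ennreal_leI)
    finally have "ennreal (V z / \<eta>) * (ennreal (\<eta> / V z) * emeasure \<mu> (ball z r)) \<le> ennreal (V z / \<eta>) * I"
      by (rule mult_left_mono) simp
    then have "emeasure \<mu> (ball z r) \<le> ennreal (V z / \<eta>) * I"
      using V_pos[of z] \<eta> by (simp add: mult.assoc[symmetric] ennreal_mult'[symmetric])
    also have "ennreal (V z / \<eta>) = ennreal (1 / \<eta>) * ennreal (V z)"
      using V_pos[of z] \<eta> by (subst ennreal_mult'[symmetric]) auto
    also have "\<dots> * I \<le> ennreal (1 / \<eta>) * (ennreal (1 / (c * r ^ m)) * emeasure \<nu> (ball z r)) * I"
      using r by (intro mult_right_mono mult_left_mono ball_lower_V) auto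
    also have "\<dots> = ennreal (1 / \<eta> * (1 / (c * r ^ m))) * I * emeasure \<nu> (ball z r)"
      using \<eta> c_pos r by (subst ennreal_mult) (auto simp: mult_ac)
    finally have *: "emeasure \<mu> (ball z r)
      \<le> ennreal (1 / \<eta> * (1 / (c * r ^ m))) * I * emeasure \<nu> (ball z r)" .
    \<comment> \<open>Cancelling the mass in an extended real quotient requires it to be neither
      zero nor infinite.\<close>
    have "emeasure \<nu> (ball z r) \<noteq> 0"
    proof
      assume "emeasure \<nu> (ball z r) = 0"
      then show False using ball_lower_V[of r z] r V_pos[of z] by simp
    qed
    moreover have "emeasure \<nu> (ball z r) \<noteq> \<infinity>"
    proof -
      have "emeasure \<nu> (ball z r) \<le> emeasure \<nu> (ball z \<rho>)"
        using r by (intro emeasure_mono) auto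
      then show ?thesis using finite_ball[of z] by (auto simp: top_unique)
    qed
    ultimately show "emeasure \<mu> (ball z r) / emeasure \<nu> (ball z r)
        \<le> ennreal (1 / \<eta> * (1 / (c * r ^ m))) *
      (\<integral>\<^sup>+x. ennreal ((cmod (kernel z x / of_real (sqrt (sqn (kernel z)))))\<^sup>2 * gauss x) \<partial>\<mu>)"
      unfolding b_def[symmetric] I_def[symmetric]
      using divide_right_mono_ennreal[OF *, of "emeasure \<nu> (ball z r)"]
      by (simp add: ennreal_mult_divide_eq)
  qed
  then show ?thesis using that[of "min \<rho> \<delta>"] \<delta> \<rho>_pos by simp
qed

text \<open>The disks are the sections of the open set of pairs at distance less than \<rho>.
  Tonelli's theorem is later applied to an integrand containing 1/V.\<close>

lemma V_measurable [measurable]: "V \<in> borel_measurable borel"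
proof -
  interpret sigma_finite_measure \<nu>
    by (rule sigma_finite_if_balls_finite[OF sets_\<nu> \<rho>_pos finite_ball])
  have "{p :: complex \<times> complex. dist (fst p) (snd p) < \<rho>} \<in> sets (borel \<Otimes>\<^sub>M \<nu>)"
  proof -
    have "open {p :: complex \<times> complex. dist (fst p) (snd p) < \<rho>}"
      by (intro open_Collect_less continuous_intros)
    then have "{p :: complex \<times> complex. dist (fst p) (snd p) < \<rho>} \<in> sets (borel \<Otimes>\<^sub>M borel)"
      unfolding borel_prod by (rule borel_open)
    then show ?thesis by (simp cong: sets_pair_measure_cong)
  qed
  from measurable_emeasure_Pair[OF this]
  have "(\<lambda>z. emeasure \<nu> (ball z \<rho>)) \<in> borel_measurable borel"
    by (simp add: vimage_def ball_def)
  then have "(\<lambda>z. enn2real (emeasure \<nu> (ball z \<rho>))) \<in> borel_measurable borel"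
    by measurable
  then show ?thesis unfolding V_def[abs_def] measure_def .
qed

text \<open>The local bound is integrated against \<mu> and the order of integration is exchanged.
  The inner integral becomes the \<mu>-mass of \<open>ball u r\<close>, at most A V(u), which
  cancels the 1/V(u) placed in the integrand and leaves the norm of \<open>f\<close>.\<close>

lemma Carleson_embedding:
  assumes r: "0 < r" "r \<le> \<rho>"
  obtains C where "0 < C"
    "\<And>\<mu> A f. \<lbrakk>sets \<mu> = sets borel; 0 \<le> A;
       \<And>z. emeasure \<mu> (ball z r) \<le> ennreal A * emeasure \<nu> (ball z r); f \<in> H\<rbrakk>
     \<Longrightarrow> (\<integral>\<^sup>+x. ennreal ((cmod (f x))\<^sup>2 * gauss x) \<partial>\<mu>) \<le> ennreal (C * A * sqn f)"
proof -
  obtain C where C: "0 < C" "\<And>f z. f holomorphic_on UNIV \<Longrightarrow> ennreal ((cmod (f z))\<^sup>2 * gauss z * V z)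
       \<le> ennreal C * (\<integral>\<^sup>+x\<in>ball z r. ennreal ((cmod (f x))\<^sup>2 * gauss x) \<partial>\<nu>)"
    using entire_local_bound[OF r] by blast
  have "(\<integral>\<^sup>+x. ennreal ((cmod (f x))\<^sup>2 * gauss x) \<partial>\<mu>) \<le> ennreal (C * K * A * sqn f)"
    if \<mu> [measurable_cong]: "sets \<mu> = sets borel" and A: "0 \<le> A"
      and avg: "\<And>z. emeasure \<mu> (ball z r) \<le> ennreal A * emeasure \<nu> (ball z r)" and f: "f \<in> H"
    for \<mu> A f
  proof -
    have [measurable]: "f \<in> borel_measurable borel" by (rule H_meas[OF f])
    define F where "F x = (cmod (f x))\<^sup>2 * gauss x" for x
    have [measurable]: "F \<in> borel_measurable borel" unfolding F_def by measurable
    have F0: "0 \<le> F x" for x by (simp add: F_def)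
    have ball_le: "emeasure \<nu> (ball z r) \<le> ennreal (V z)" for z
      unfolding emeasure_V[symmetric] using r by (intro emeasure_mono) auto
    have \<mu>_ball: "emeasure \<mu> (ball z r) \<le> ennreal (A * V z)" for z
    proof -
      have "emeasure \<mu> (ball z r) \<le> ennreal A * ennreal (V z)"
        by (rule order_trans[OF avg mult_left_mono[OF ball_le]]) simp
      then show ?thesis using A by (simp add: ennreal_mult')
    qed
    interpret \<nu>: sigma_finite_measure \<nu>
      by (rule sigma_finite_if_balls_finite[OF sets_\<nu> \<rho>_pos finite_ball])
    interpret \<mu>: sigma_finite_measure \<mu>
      by (rule sigma_finite_if_balls_finite[OF \<mu> r(1)])
        (rule le_less_trans[OF \<mu>_ball], simp)
    interpret pair_sigma_finite \<nu> \<mu> ..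
    \<comment> \<open>The local bound carries 1/V(x); doubling replaces it by K/V(u), so that this
      factor leaves the inner integral after the exchange.\<close>
    define G where "G u = ennreal (C * K * F u / V u)" for u
    have [measurable]: "G \<in> borel_measurable borel" unfolding G_def by measurable
    \<comment> \<open>Proximity is written as an indicator on pairs to obtain the joint
      measurability required for the exchange.\<close>
    define J :: "complex \<Rightarrow> complex \<Rightarrow> ennreal"
      where "J u x = G u * indicator {p. dist (fst p) (snd p) < r} (u, x)" for u x
    have J: "case_prod J \<in> borel_measurable (\<nu> \<Otimes>\<^sub>M \<mu>)"
      unfolding J_def by measurable
    have "ennreal (F x) \<le> (\<integral>\<^sup>+u. J u x \<partial>\<nu>)" for x
    proof -
      have "ennreal (1 / V x) * ennreal (F x * V x)
          \<le> ennreal (1 / V x) * (ennreal C * (\<integral>\<^sup>+u\<in>ball x r. ennreal (F u) \<partial>\<nu>))"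
        unfolding F_def by (intro mult_left_mono C(2) H_hol f) simp
      also have "ennreal (1 / V x) * ennreal (F x * V x) = ennreal (F x)"
        using V_pos[of x] by (subst ennreal_mult'[symmetric]) auto
      also have "ennreal (1 / V x) * (ennreal C * (\<integral>\<^sup>+u\<in>ball x r. ennreal (F u) \<partial>\<nu>))
          = (\<integral>\<^sup>+u. ennreal (C / V x) * (ennreal (F u) * indicator (ball x r) u) \<partial>\<nu>)"
        using V_pos[of x] C(1)
        by (subst nn_integral_cmult) (auto simp: mult.assoc[symmetric] ennreal_mult'[symmetric])
      also have "\<dots> \<le> (\<integral>\<^sup>+u. J u x \<partial>\<nu>)"
      proof (rule nn_integral_mono)
        fix u
        show "ennreal (C / V x) * (ennreal (F u) * indicator (ball x r) u) \<le> J u x"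
        proof (cases "dist u x < r")
          case True
          then have "V u \<le> K * V x" using r by (intro V_doubling) auto
          then have "C / V x \<le> C * K / V u"
            using C(1) V_pos[of x] V_pos[of u] by (simp add: field_simps)
          then have "C / V x * F u \<le> C * K / V u * F u"
            by (intro mult_right_mono F0)
          then show ?thesis
            using True C(1) V_pos[of x] by (simp add: J_def G_def dist_commute ennreal_mult'[symmetric] ennreal_leI)
        qed (simp add: dist_commute)
      qed
      finally show ?thesis .
    qed
    then have "(\<integral>\<^sup>+x. ennreal (F x) \<partial>\<mu>) \<le> (\<integral>\<^sup>+x. (\<integral>\<^sup>+u. J u x \<partial>\<nu>) \<partial>\<mu>)"
      by (intro nn_integral_mono)
    also have "\<dots> = (\<integral>\<^sup>+u. (\<integral>\<^sup>+x. J u x \<partial>\<mu>) \<partial>\<nu>)"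
      by (rule Fubini'[OF J])
    also have "\<dots> \<le> (\<integral>\<^sup>+u. ennreal (C * K * A) * ennreal (F u) \<partial>\<nu>)"
    proof (rule nn_integral_mono)
      fix u
      have "(\<integral>\<^sup>+x. J u x \<partial>\<mu>) = (\<integral>\<^sup>+x. G u * indicator (ball u r) x \<partial>\<mu>)"
        by (rule nn_integral_cong) (auto simp: J_def indicator_def)
      also have "\<dots> = G u * emeasure \<mu> (ball u r)"
        by (rule nn_integral_cmult_indicator) measurable
      also have "\<dots> \<le> G u * ennreal (A * V u)" by (intro mult_left_mono \<mu>_ball) simp
      also have "\<dots> = ennreal (C * K * F u / V u * (A * V u))"
        unfolding G_def using C(1) K_pos F0 V_pos[of u] by (intro ennreal_mult'[symmetric]) simp
      also have "C * K * F u / V u * (A * V u) = C * K * A * F u" using V_pos[of u] by simp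
      also have "ennreal (C * K * A * F u) = ennreal (C * K * A) * ennreal (F u)"
        using C(1) K_pos A by (intro ennreal_mult') simp
      finally show "(\<integral>\<^sup>+x. J u x \<partial>\<mu>) \<le> ennreal (C * K * A) * ennreal (F u)" .
    qed
    also have "\<dots> = ennreal (C * K * A) * (\<integral>\<^sup>+u. ennreal (F u) \<partial>\<nu>)"
      by (rule nn_integral_cmult) measurable
    also have "(\<integral>\<^sup>+u. ennreal (F u) \<partial>\<nu>) = (\<integral>\<^sup>+u. ennreal ((cmod (f u))\<^sup>2) \<partial>M)"
      unfolding F_def by (rule nn_integral_M[symmetric]) measurable
    also have "\<dots> = ennreal (sqn f)"
      unfolding sqn_def by (intro nn_integral_eq_integral H_int f) auto
    also have "ennreal (C * K * A) * ennreal (sqn f) = ennreal (C * K * A * sqn f)"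
      using C(1) K_pos A by (intro ennreal_mult'[symmetric]) simp
    finally show ?thesis unfolding F_def .
  qed
  moreover have "0 < C * K" using C(1) K_pos by simp
  ultimately show ?thesis using that[of "C * K"] by blast
qed

end

section \<open>Restricted Muckenhoupt weights\<close>

text \<open>Integrability is given on compact sets only, so measurability on the plane is obtained
  from truncations to growing disks.\<close>

lemma weight_measurable:
  assumes "is_weight w" shows "w \<in> borel_measurable lebesgue"
proof (rule borel_measurable_LIMSEQ_real)
  show "(\<lambda>x. indicat_real (cball 0 (real n)) x * w x) \<in> borel_measurable lebesgue" for n
  proof -
    have "set_integrable lebesgue (cball 0 (real n)) w"
      using assms by (simp add: is_weight_def)
    from borel_measurable_integrable[OF this[unfolded set_integrable_def]]
    show ?thesis by simp
  qed
  show "(\<lambda>n. indicat_real (cball 0 (real n)) x * w x) \<longlonglongrightarrow> w x" for x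
  proof (rule tendsto_eventually)
    obtain N where "cmod x \<le> real N" using real_arch_simple by blast
    then show "\<forall>\<^sub>F n in sequentially. indicat_real (cball 0 (real n)) x * w x = w x"
      by (intro eventually_sequentiallyI[of N]) auto
  qed
qed

lemma weight_mass_compact_finite:
  assumes "is_weight w" "compact S" shows "weight_mass w S < \<infinity>"
proof -
  have "set_integrable lebesgue S w" using assms by (simp add: is_weight_def)
  then have "(\<integral>\<^sup>+x. ennreal (norm (indicat_real S x *\<^sub>R w x)) \<partial>lebesgue) < \<infinity>"
    unfolding set_integrable_def integrable_iff_bounded by simp
  also have "(\<integral>\<^sup>+x. ennreal (norm (indicat_real S x *\<^sub>R w x)) \<partial>lebesgue) = weight_mass w S"
    unfolding weight_mass_def
    using assms(1) by (intro nn_integral_cong) (auto simp: is_weight_def indicator_def)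
  finally show ?thesis .
qed

lemma emeasure_square:
  assumes "0 < r" shows "emeasure lebesgue (square a r) = ennreal (r\<^sup>2)"
proof -
  have "emeasure lborel (square a r) = (\<Prod>b\<in>Basis. (Complex r r) \<bullet> b)"
    unfolding square_def using assms
    by (subst emeasure_lborel_cbox) (auto simp: Basis_complex_def)
  also have "(\<Prod>b\<in>Basis. (Complex r r) \<bullet> b) = r\<^sup>2"
    by (simp add: Basis_complex_def power2_eq_square)
  finally show ?thesis by (simp add: square_def)
qed

lemma square_lebesgue [measurable]: "square a r \<in> sets lebesgue"
  by (simp add: square_def)

lemma ennreal_powr_measurable [measurable]:
  assumes [measurable]: "f \<in> borel_measurable M"
  shows "(\<lambda>x. ennreal_powr (f x) s) \<in> borel_measurable M"
  unfolding ennreal_powr_def by measurable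

lemma ennreal_powr_pos:
  assumes "0 < x" shows "0 < ennreal_powr x s"
  using assms by (cases x) (auto simp: ennreal_powr_def ennreal_less_zero_iff zero_less_iff_neq_zero)

lemma ennreal_powr_ennreal: "0 \<le> x \<Longrightarrow> ennreal_powr (ennreal x) s = ennreal (x powr s)"
  by (simp add: ennreal_powr_def)

lemma SUP_finite_bound:
  fixes f :: "'a \<Rightarrow> ennreal"
  assumes "(SUP a. f a) < \<infinity>"
  obtains k where "0 < k" "\<And>a. f a \<le> ennreal k"
proof -
  obtain k where k: "(SUP a. f a) = ennreal k" "0 \<le> k"
    using assms by (cases "SUP a. f a") auto
  have "f a \<le> ennreal (k + 1)" for a
  proof -
    have "f a \<le> ennreal k" unfolding k(1)[symmetric] by (rule SUP_upper) simp
    also have "\<dots> \<le> ennreal (k + 1)" by (rule ennreal_leI) simp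
    finally show ?thesis .
  qed
  then show ?thesis using k(2) that[of "k + 1"] by simp
qed

text \<open>Removing the part where \<open>w\<close> is at most \<open>l\<close> leaves measure at
  least e - b, on which \<open>w\<close> exceeds \<open>l\<close>.\<close>

lemma weight_mass_lower:
  assumes w [measurable]: "w \<in> borel_measurable lebesgue" and [measurable]: "E \<in> sets lebesgue"
    and E: "emeasure lebesgue E = ennreal e" and b: "0 \<le> b" "b < e"
    and small: "emeasure lebesgue {x \<in> E. w x \<le> l} \<le> ennreal b" and l: "0 \<le> l"
  shows "ennreal (l * (e - b)) \<le> weight_mass w E"
proof -
  let ?B = "{x \<in> E. w x \<le> l}" and ?G = "{x \<in> E. \<not> w x \<le> l}"
  have meas: "{x \<in> E. w x \<le> l} \<in> sets lebesgue" "{x \<in> E. \<not> w x \<le> l} \<in> sets lebesgue"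
  proof -
    have "{x \<in> space lebesgue. x \<in> E \<and> w x \<le> l} \<in> sets lebesgue"
      "{x \<in> space lebesgue. x \<in> E \<and> \<not> w x \<le> l} \<in> sets lebesgue" by measurable
    then show "{x \<in> E. w x \<le> l} \<in> sets lebesgue" "{x \<in> E. \<not> w x \<le> l} \<in> sets lebesgue" by simp_all
  qed
  have "emeasure lebesgue E \<le> emeasure lebesgue ?B + emeasure lebesgue ?G"
    using emeasure_subadditive[OF meas] by (simp add: Un_def Collect_disj_eq[symmetric] conj_disj_distribL[symmetric])
  then have "ennreal e \<le> ennreal b + emeasure lebesgue ?G"
    using small unfolding E by (meson add_right_mono order_trans)
  then have "ennreal (e - b) \<le> emeasure lebesgue ?G"
    using b by (simp add: ennreal_minus[symmetric] ennreal_minus_le_iff)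
  then have "ennreal (l * (e - b)) \<le> ennreal l * emeasure lebesgue ?G"
    using l by (simp add: ennreal_mult' mult_left_mono)
  also have "\<dots> = (\<integral>\<^sup>+x. ennreal l * indicator ?G x \<partial>lebesgue)"
    using meas(2) by (simp add: nn_integral_cmult_indicator)
  also have "\<dots> \<le> weight_mass w E"
    unfolding weight_mass_def by (intro nn_integral_mono) (auto simp: indicator_def intro!: ennreal_leI)
  finally show ?thesis .
qed

text \<open>The usual consequence of an A_p condition for subsets of a square, with the side length
  absorbed into \<open>k\<close>. Positivity is stated separately because the power bound says
  nothing when the square has mass zero.\<close>

definition weight_lower_power :: "(complex \<Rightarrow> real) \<Rightarrow> real \<Rightarrow> real \<Rightarrow> real \<Rightarrow> bool" where
  "weight_lower_power w r k p \<longleftrightarrow> (\<forall>a E e. E \<in> sets lebesgue \<longrightarrow> E \<subseteq> square a r \<longrightarrow>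
     emeasure lebesgue E = ennreal e \<longrightarrow> 0 < e \<longrightarrow>
     0 < weight_mass w E \<and> ennreal (k * e powr p) * weight_mass w (square a r) \<le> weight_mass w E)"

text \<open>If \<open>w\<close> is small on a set, the dual weight is large there, and Markov's
  inequality makes this set small. At a suitable level at least half of \<open>E\<close>
  remains.\<close>

lemma A_p_weight_lower_power:
  assumes p: "1 < p" and w: "w \<in> A_p_restricted p"
  shows "\<exists>r>0. \<exists>k>0. weight_lower_power w r k p"
proof -
  define t where "t = 1 / (p - 1)"
  have t: "0 < t" "conj_exponent p / p = t" "p / conj_exponent p = p - 1" "t * (p - 1) = 1"
    using p by (auto simp: t_def conj_exponent_def)
  have wt: "is_weight w" using w by (simp add: A_p_restricted_def)
  note wm [measurable] = weight_measurable[OF wt]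
  define dual where "dual r a = average (square a r) (\<lambda>z. ennreal_powr (inverse (ennreal (w z))) t)" for r a
  obtain r where r: "0 < r" and fin: "\<And>a. dual r a < \<infinity>"
    and sup: "(SUP a. average (square a r) (\<lambda>z. ennreal (w z)) * ennreal_powr (dual r a) (p - 1)) < \<infinity>"
    using w unfolding A_p_restricted_def Let_def t(2,3) dual_def by blast
  obtain k0 where k0: "0 < k0"
    and avg: "\<And>a. average (square a r) (\<lambda>z. ennreal (w z)) * ennreal_powr (dual r a) (p - 1) \<le> ennreal k0"
    using SUP_finite_bound[OF sup] by blast
  \<comment> \<open>Determined by the last comparison, where the bound
    \<open>k0 * r\<^sup>2 / y powr (p - 1)\<close> for the mass of the square meets
    \<open>l * (e / 2)\<close>.\<close>
  define k where "k = 1 / (k0 * r\<^sup>2 * 2 powr p * (r\<^sup>2) powr (p - 1))"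
  have k: "0 < k" using k0 r by (simp add: k_def)
  have "0 < weight_mass w E \<and> ennreal (k * e powr p) * weight_mass w (square a r) \<le> weight_mass w E"
    if [measurable]: "E \<in> sets lebesgue" and sub: "E \<subseteq> square a r"
      and E: "emeasure lebesgue E = ennreal e" and e: "0 < e" for a E e
  proof -
    define u where "u x = ennreal_powr (inverse (ennreal (w x))) t" for x
    have [measurable]: "u \<in> borel_measurable lebesgue" unfolding u_def by measurable
    define I where "I = (\<integral>\<^sup>+x\<in>square a r. u x \<partial>lebesgue)"
    have dual_I: "dual r a = I / ennreal (r\<^sup>2)"
      by (simp add: dual_def average_def I_def u_def emeasure_square[OF r])
    obtain y where y: "dual r a = ennreal y" "0 \<le> y"
      using fin[of a] by (cases "dual r a") auto
    have I: "I = ennreal (r\<^sup>2 * y)"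
    proof -
      have "I = ennreal (r\<^sup>2) * dual r a"
        unfolding dual_I using r by (simp add: ennreal_mult_divide_eq mult.commute ennreal_times_divide)
      then show ?thesis using y by (simp add: ennreal_mult)
    qed
    \<comment> \<open>The dual weight is positive everywhere because \<open>w\<close> has finite
      values. This gives y > 0, by which the level \<open>l\<close> divides.\<close>
    have "I \<noteq> 0"
    proof
      assume "I = 0"
      then have "AE x in lebesgue. u x * indicator (square a r) x = 0"
        unfolding I_def by (subst (asm) nn_integral_0_iff_AE) auto
      moreover have "u x \<noteq> 0" for x
        unfolding u_def by (intro ennreal_powr_pos[THEN less_imp_neq, symmetric])
          (simp add: ennreal_inverse_positive)
      ultimately have "AE x in lebesgue. x \<notin> square a r"
        by (auto elim!: eventually_mono simp: indicator_def split: if_splits)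
      then have "emeasure lebesgue (square a r) = 0"
        by (subst (asm) AE_iff_measurable[of "square a r"]) auto
      then show False using emeasure_square[OF r] r by simp
    qed
    then have y0: "0 < y" using I y(2) by (cases "y = 0") auto
    \<comment> \<open>Chosen so that the Markov bound \<open>l powr t * I\<close> equals
      e/2.\<close>
    define l where "l = (e / (2 * r\<^sup>2 * y)) powr (p - 1)"
    have l: "0 < l" using e r y0 by (simp add: l_def)
    have lt: "l powr t = e / (2 * r\<^sup>2 * y)"
      using e r y0 t(4) by (simp add: l_def powr_powr mult.commute)
    have "emeasure lebesgue {x \<in> E. w x \<le> l} \<le> emeasure lebesgue {x \<in> square a r. 1 \<le> ennreal (l powr t) * u x}"
    proof (rule emeasure_mono)
      show "{x \<in> E. w x \<le> l} \<subseteq> {x \<in> square a r. 1 \<le> ennreal (l powr t) * u x}"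
      proof safe
        fix x assume x: "x \<in> E" "w x \<le> l"
        then show "x \<in> square a r" using sub by blast
        have w0: "0 \<le> w x" using wt by (simp add: is_weight_def)
        show "1 \<le> ennreal (l powr t) * u x"
        proof (cases "w x = 0")
          \<comment> \<open>At a zero of \<open>w\<close> the convention
            \<open>inverse 0 = \<infinity>\<close> makes the dual weight infinite.\<close>
          case True
          then show ?thesis using l by (simp add: u_def ennreal_powr_def ennreal_mult_top)
        next
          case False
          then have "0 < w x" using w0 by simp
          then have "u x = ennreal (inverse (w x) powr t)"
            by (simp add: u_def inverse_ennreal ennreal_powr_ennreal)
          moreover have "1 \<le> l powr t * inverse (w x) powr t"
          proof -
            have "1 powr t \<le> (l * inverse (w x)) powr t"
              using \<open>0 < w x\<close> x(2) t(1) by (intro powr_mono2) (auto simp: field_simps)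
            then show ?thesis using l \<open>0 < w x\<close> by (simp add: powr_mult)
          qed
          ultimately show ?thesis
            by (metis ennreal_1 ennreal_leI ennreal_mult' powr_ge_zero)
        qed
      qed
      have "{x \<in> space lebesgue. x \<in> square a r \<and> 1 \<le> ennreal (l powr t) * u x} \<in> sets lebesgue"
        by measurable
      then show "{x \<in> square a r. 1 \<le> ennreal (l powr t) * u x} \<in> sets lebesgue"
        unfolding space_completion space_lborel space_borel by (simp only: UNIV_I simp_thms)
    qed
    also have "\<dots> \<le> ennreal (l powr t) * I"
      unfolding I_def by (rule nn_integral_Markov_inequality) measurable
    also have "\<dots> = ennreal (l powr t * (r\<^sup>2 * y))"
      unfolding I by (rule ennreal_mult'[symmetric]) simp
    also have "l powr t * (r\<^sup>2 * y) = e / 2"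
      unfolding lt using r y0 by (simp add: field_simps)
    finally have small: "emeasure lebesgue {x \<in> E. w x \<le> l} \<le> ennreal (e / 2)" .
    have "ennreal (l * (e - e / 2)) \<le> weight_mass w E"
      by (rule weight_mass_lower[OF wm _ E _ _ small]) (use e l in auto)
    then have low: "ennreal (l * (e / 2)) \<le> weight_mass w E" by simp
    have pos: "0 < ennreal (l * (e / 2))" using l e by simp
    have "compact (square a r)" by (simp add: square_def)
    then obtain W where W: "weight_mass w (square a r) = ennreal W" "0 \<le> W"
      using weight_mass_compact_finite[OF wt, of "square a r"]
      by (cases "weight_mass w (square a r)") auto
    have "ennreal (W / r\<^sup>2 * y powr (p - 1)) \<le> ennreal k0"
    proof -
      have "average (square a r) (\<lambda>z. ennreal (w z)) = ennreal (W / r\<^sup>2)"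
        unfolding average_def emeasure_square[OF r] weight_mass_def[symmetric] W(1)
        using W(2) r by (simp add: divide_ennreal)
      then have "ennreal (W / r\<^sup>2) * ennreal (y powr (p - 1)) \<le> ennreal k0"
        using avg[of a] unfolding y(1) ennreal_powr_ennreal[OF y(2)] by metis
      moreover have "0 \<le> W / r\<^sup>2" using W(2) by simp
      ultimately show ?thesis by (metis ennreal_mult')
    qed
    then have "W / r\<^sup>2 * y powr (p - 1) \<le> k0" using k0 by simp
    then have Wk: "W \<le> k0 * r\<^sup>2 / y powr (p - 1)" using r y0 by (simp add: field_simps)
    have "k * e powr p * W \<le> k * e powr p * (k0 * r\<^sup>2 / y powr (p - 1))"
      using k e by (intro mult_left_mono Wk) auto
    also have "\<dots> = e powr p / (2 powr p * (r\<^sup>2) powr (p - 1) * y powr (p - 1))"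
      using k0 r by (simp add: k_def)
    also have "\<dots> = l * (e / 2)"
    proof -
      have "e powr p = e powr (p - 1) * e" "2 powr p = 2 powr (p - 1) * (2::real)"
        using e powr_add[of e "p - 1" 1] powr_add[of 2 "p - 1" 1] by simp_all
      then show ?thesis
        using e r y0 by (simp add: l_def powr_divide powr_mult)
    qed
    finally have "ennreal (k * e powr p * W) \<le> ennreal (l * (e / 2))" by (rule ennreal_leI)
    then have "ennreal (k * e powr p) * weight_mass w (square a r) \<le> ennreal (l * (e / 2))"
      using W by (simp add: ennreal_mult'')
    from order_trans[OF this low] less_le_trans[OF pos low] show ?thesis by blast
  qed
  then have "weight_lower_power w r k p" unfolding weight_lower_power_def by blast
  then show ?thesis using r k by blast
qed

text \<open>The essential bound on 1/w plays the part of Markov's inequality: \<open>w\<close> is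
  almost everywhere at least 1/y, so below a smaller level there is only a null set.\<close>

lemma A_1_weight_lower_power:
  assumes w: "w \<in> A_1_restricted"
  shows "\<exists>r>0. \<exists>k>0. weight_lower_power w r k 1"
proof -
  have wt: "is_weight w" using w by (simp add: A_1_restricted_def)
  note wm [measurable] = weight_measurable[OF wt]
  define dual where
    "dual r a = esssup (restrict_space lebesgue (square a r)) (\<lambda>z. inverse (ennreal (w z)))" for r a
  obtain r where r: "0 < r" and fin: "\<And>a. dual r a < \<infinity>"
    and sup: "(SUP a. average (square a r) (\<lambda>z. ennreal (w z)) * dual r a) < \<infinity>"
    using w unfolding A_1_restricted_def Let_def dual_def by blast
  obtain k0 where k0: "0 < k0"
    and avg: "\<And>a. average (square a r) (\<lambda>z. ennreal (w z)) * dual r a \<le> ennreal k0"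
    using SUP_finite_bound[OF sup] by blast
  define k where "k = 1 / (2 * k0 * r\<^sup>2)"
  have k: "0 < k" using k0 r by (simp add: k_def)
  have "0 < weight_mass w E \<and> ennreal (k * e powr 1) * weight_mass w (square a r) \<le> weight_mass w E"
    if [measurable]: "E \<in> sets lebesgue" and sub: "E \<subseteq> square a r"
      and E: "emeasure lebesgue E = ennreal e" and e: "0 < e" for a E e
  proof -
    obtain y where y: "dual r a = ennreal y" "0 \<le> y"
      using fin[of a] by (cases "dual r a") auto
    have AE: "AE x in lebesgue. x \<in> square a r \<longrightarrow> inverse (ennreal (w x)) \<le> ennreal y"
      using esssup_AE[where M = "restrict_space lebesgue (square a r)" and f = "\<lambda>z. inverse (ennreal (w z))"]
      unfolding y(1)[symmetric] dual_def by (subst (asm) AE_restrict_space_iff) auto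
    have y0: "0 < y"
    proof (rule ccontr)
      assume "\<not> 0 < y"
      then have "AE x in lebesgue. x \<notin> square a r"
        using AE y(2) by (auto elim!: eventually_mono simp: ennreal_inverse_eq_0_iff)
      then have "emeasure lebesgue (square a r) = 0"
        by (subst (asm) AE_iff_measurable[of "square a r"]) auto
      then show False using emeasure_square[OF r] r by simp
    qed
    \<comment> \<open>Half of the essential lower bound 1/y, so that \<open>w x \<le> l\<close>
      contradicts it.\<close>
    define l where "l = 1 / (2 * y)"
    have l: "0 < l" using y0 by (simp add: l_def)
    have "AE x in lebesgue. x \<notin> {x \<in> E. w x \<le> l}"
      using AE
    proof (rule eventually_mono)
      fix x assume x: "x \<in> square a r \<longrightarrow> inverse (ennreal (w x)) \<le> ennreal y"
      show "x \<notin> {x \<in> E. w x \<le> l}"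
      proof
        assume "x \<in> {x \<in> E. w x \<le> l}"
        then have *: "inverse (ennreal (w x)) \<le> ennreal y" "w x \<le> l" using x sub by auto
        then have "w x \<noteq> 0" by (auto simp: top_unique)
        moreover have "0 \<le> w x" using wt by (simp add: is_weight_def)
        ultimately have "0 < w x" by simp
        then have "inverse (w x) \<le> y" using * y0 by (simp add: inverse_ennreal)
        then have "1 \<le> y * w x" using \<open>0 < w x\<close> by (simp add: field_simps)
        also have "\<dots> \<le> y * l" using *(2) y0 by (intro mult_left_mono) auto
        finally show False using y0 by (simp add: l_def)
      qed
    qed
    moreover have "{x \<in> space lebesgue. x \<in> E \<and> w x \<le> l} \<in> sets lebesgue" by measurable
    ultimately have small: "emeasure lebesgue {x \<in> E. w x \<le> l} \<le> ennreal 0"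
      by (subst (asm) AE_iff_measurable[of "{x \<in> E. w x \<le> l}"]) auto
    have "ennreal (l * (e - 0)) \<le> weight_mass w E"
      by (rule weight_mass_lower[OF wm _ E _ _ small]) (use e l in auto)
    then have low: "ennreal (l * e) \<le> weight_mass w E" by simp
    have pos: "0 < ennreal (l * e)" using l e by simp
    have "compact (square a r)" by (simp add: square_def)
    then obtain W where W: "weight_mass w (square a r) = ennreal W" "0 \<le> W"
      using weight_mass_compact_finite[OF wt, of "square a r"]
      by (cases "weight_mass w (square a r)") auto
    have "ennreal (W / r\<^sup>2 * y) \<le> ennreal k0"
    proof -
      have "average (square a r) (\<lambda>z. ennreal (w z)) = ennreal (W / r\<^sup>2)"
        unfolding average_def emeasure_square[OF r] weight_mass_def[symmetric] W(1)
        using W(2) r by (simp add: divide_ennreal)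
      then have "ennreal (W / r\<^sup>2) * ennreal y \<le> ennreal k0"
        using avg[of a] unfolding y(1) by metis
      moreover have "0 \<le> W / r\<^sup>2" using W(2) by simp
      ultimately show ?thesis by (metis ennreal_mult')
    qed
    then have "W / r\<^sup>2 * y \<le> k0" using k0 by simp
    then have Wk: "W \<le> k0 * r\<^sup>2 / y" using r y0 by (simp add: field_simps)
    have "k * e * W \<le> k * e * (k0 * r\<^sup>2 / y)"
      using k e by (intro mult_left_mono Wk) auto
    also have "\<dots> = l * e" using k0 r y0 by (simp add: k_def l_def)
    finally have "ennreal (k * e * W) \<le> ennreal (l * e)" by (rule ennreal_leI)
    then have "ennreal (k * e powr 1) * weight_mass w (square a r) \<le> ennreal (l * e)"
      using W e by (simp add: ennreal_mult'')
    from order_trans[OF this low] less_le_trans[OF pos low] show ?thesis by blast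
  qed
  then have "weight_lower_power w r k 1" unfolding weight_lower_power_def by blast
  then show ?thesis using r k by blast
qed

section \<open>From restricted weights to doubling measures on Borel sets\<close>

lemma ident_lebesgue_borel: "(\<lambda>z. z) \<in> measurable lebesgue borel"
  by (rule measurable_completion) simp

text \<open>A weight is only Lebesgue measurable, whereas \<mu> and the abstract theory live on
  Borel sets; the image under the identity restricts the density to these.\<close>

definition weight_measure :: "(complex \<Rightarrow> real) \<Rightarrow> complex measure" where
  "weight_measure w = distr (density lebesgue (\<lambda>z. ennreal (w z))) borel (\<lambda>z. z)"

lemma emeasure_weight_measure:
  assumes [measurable]: "w \<in> borel_measurable lebesgue" and B: "B \<in> sets borel"
  shows "emeasure (weight_measure w) B = weight_mass w B"
proof -
  have m: "(\<lambda>z. z) \<in> measurable (density lebesgue (\<lambda>z. ennreal (w z))) borel"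
    using ident_lebesgue_borel by simp
  have "B \<in> sets lebesgue" using B by simp
  then show ?thesis
    unfolding weight_measure_def weight_mass_def
    by (subst emeasure_distr[OF m B]) (simp add: emeasure_density)
qed

lemma A_infty_doubling_measure:
  assumes "w \<in> A_infty_restricted"
  shows "is_weight w" "\<exists>\<rho> c m. doubling_measure (weight_measure w) \<rho> c m"
proof -
  show wt: "is_weight w"
    using assms by (auto simp: A_infty_restricted_def A_1_restricted_def A_p_restricted_def)
  note wm [measurable] = weight_measurable[OF wt]
  obtain p r k where p: "1 \<le> p" and r: "0 < r" and k: "0 < k" and low: "weight_lower_power w r k p"
    using assms A_1_weight_lower_power A_p_weight_lower_power
    unfolding A_infty_restricted_def by (metis UN_E Un_iff greaterThan_iff less_imp_le order_refl)
  define \<rho> where "\<rho> = r / 2"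
  have \<rho>: "0 < \<rho>" using r by (simp add: \<rho>_def)
  \<comment> \<open>The area of a disk is quadratic in the radius, so the exponent \<open>p\<close>
    for areas becomes 2p for radii.\<close>
  obtain m0 :: nat where m0: "2 * p \<le> real m0" using real_arch_simple by blast
  define m where "m = Suc m0"
  \<comment> \<open>Normalised so that \<open>c * s ^ m\<close> equals
    \<open>k * (pi * \<rho>\<^sup>2) powr p * (s / \<rho>) ^ m\<close>; since s \<le> \<rho>,
    enlarging the exponent only decreases the last factor.\<close>
  define c where "c = k * (pi * \<rho>\<^sup>2) powr p / \<rho> ^ m"
  \<comment> \<open>The square of side 2 \<rho> centred at \<open>z\<close>.\<close>
  define sq where "sq z = square (z - Complex \<rho> \<rho>) r" for z
  have ball_sq: "ball z \<rho> \<subseteq> sq z" for z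
  proof
    fix x assume "x \<in> ball z \<rho>"
    then have "cmod (x - z) < \<rho>" by (simp add: dist_norm norm_minus_commute)
    then have "\<bar>Re x - Re z\<bar> < \<rho>" "\<bar>Im x - Im z\<bar> < \<rho>"
      using abs_Re_le_cmod[of "x - z"] abs_Im_le_cmod[of "x - z"] by simp_all
    then show "x \<in> sq z"
      unfolding sq_def square_def in_cbox_complex_iff by (simp add: \<rho>_def abs_less_iff) argo
  qed
  have nu: "emeasure (weight_measure w) (ball x s) = weight_mass w (ball x s)" for x s
    by (rule emeasure_weight_measure) auto
  have mass_mono: "weight_mass w A \<le> weight_mass w B" if "A \<subseteq> B" for A B
    unfolding weight_mass_def using that by (intro nn_integral_mono) (auto simp: indicator_def)
  have area: "emeasure lebesgue (ball x s) = ennreal (pi * s\<^sup>2)" if "0 < s" for x :: complex and s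
    using emeasure_ball[of s x] that by (simp add: unit_ball_vol_2)
  have "doubling_measure (weight_measure w) \<rho> c m"
  proof
    show "sets (weight_measure w) = sets borel" by (simp add: weight_measure_def)
    show "0 < \<rho>" by fact
    show "0 < c" using k \<rho> by (simp add: c_def)
    show "0 < m" by (simp add: m_def)
    show "emeasure (weight_measure w) (ball z \<rho>) < \<infinity>" for z
      using le_less_trans[OF mass_mono weight_mass_compact_finite[OF wt compact_cball], OF ball_subset_cball]
      by (simp add: nu)
    show "0 < emeasure (weight_measure w) (ball z \<rho>)" for z
      using low[unfolded weight_lower_power_def, rule_format, of "ball z \<rho>" "z - Complex \<rho> \<rho>" "pi * \<rho>\<^sup>2"]
        ball_sq[of z] area[OF \<rho>] \<rho> by (simp add: nu sq_def)
    fix x z :: complex and s assume s: "0 < s" and sub: "ball x s \<subseteq> ball z \<rho>"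
    then have "s \<le> \<rho>" using ball_subset_ball_iff[of x s z \<rho>] zero_le_dist[of x z] by linarith
    have "(s / \<rho>) ^ m = (s / \<rho>) powr real m" using s \<rho> by (simp add: powr_realpow)
    also have "\<dots> \<le> (s / \<rho>) powr (2 * p)"
      using s \<rho> \<open>s \<le> \<rho>\<close> m0 by (intro powr_mono') (auto simp: m_def)
    also have "\<dots> = (s\<^sup>2 / \<rho>\<^sup>2) powr p"
      using s \<rho> by (simp add: powr_powr[symmetric] power_divide powr_numeral)
    finally have "k * (pi * \<rho>\<^sup>2) powr p * (s / \<rho>) ^ m \<le> k * (pi * \<rho>\<^sup>2) powr p * (s\<^sup>2 / \<rho>\<^sup>2) powr p"
      using k by (intro mult_left_mono) auto
    also have "\<dots> = k * (pi * s\<^sup>2) powr p"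
      using s \<rho> by (simp add: powr_mult[symmetric] mult.assoc)
    finally have cs: "c * s ^ m \<le> k * (pi * s\<^sup>2) powr p"
      by (simp add: c_def power_divide)
    have "ennreal (c * s ^ m) * weight_mass w (ball z \<rho>)
        \<le> ennreal (k * (pi * s\<^sup>2) powr p) * weight_mass w (sq z)"
      by (intro mult_mono[OF ennreal_leI[OF cs] mass_mono[OF ball_sq]]) auto
    also have "\<dots> \<le> weight_mass w (ball x s)"
      using low[unfolded weight_lower_power_def, rule_format, of "ball x s" "z - Complex \<rho> \<rho>" "pi * s\<^sup>2"]
        order_trans[OF sub ball_sq[of z]] area[OF s] s by (simp add: sq_def)
    finally show "ennreal (c * s ^ m) * emeasure (weight_measure w) (ball z \<rho>)
        \<le> emeasure (weight_measure w) (ball x s)" by (simp add: nu)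
  qed
  then show "\<exists>\<rho> c m. doubling_measure (weight_measure w) \<rho> c m" by blast
qed

section \<open>Toeplitz operators on weighted Fock spaces\<close>

lemma borel_imp_lebesgue_measurable:
  assumes "g \<in> measurable borel N" shows "g \<in> measurable lebesgue N"
  by (rule measurable_completion) (simp add: assms)

locale weighted_fock_density = weighted_fock "weight_measure w" \<rho> c m \<alpha>
  for w :: "complex \<Rightarrow> real" and \<rho> c m \<alpha> +
  assumes weight: "is_weight w"
begin

section \<open>Identifying the Fock space notions with the abstract ones\<close>

lemma w_measurable [measurable]: "w \<in> borel_measurable lebesgue"
  by (rule weight_measurable[OF weight])

lemma w_nonneg: "0 \<le> w z"
  using weight by (simp add: is_weight_def)

text \<open>The layers of \<open>M\<close> are unwound one by one: the Gaussian density, the passage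
  to Borel sets, and the density \<open>w\<close>.\<close>

lemma
  fixes g :: "complex \<Rightarrow> 'b::{banach, second_countable_topology}"
  assumes g [measurable]: "g \<in> borel_measurable borel"
  shows integrable_M_iff: "integrable M g \<longleftrightarrow> integrable lebesgue (\<lambda>z. (gauss z * w z) *\<^sub>R g z)"
    and integral_M: "(\<integral>z. g z \<partial>M) = (\<integral>z. (gauss z * w z) *\<^sub>R g z \<partial>lebesgue)"
proof -
  note [measurable] = borel_imp_lebesgue_measurable[OF g] borel_imp_lebesgue_measurable[OF gauss_measurable]
  let ?D = "density lebesgue (\<lambda>z. ennreal (w z))"
  have gw: "g \<in> borel_measurable (weight_measure w)" "gauss \<in> borel_measurable (weight_measure w)"
    using g gauss_measurable by (simp_all cong: measurable_cong_sets)
  have gl: "(\<lambda>z. gauss z *\<^sub>R g z) \<in> borel_measurable lebesgue" by measurable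
  have id: "(\<lambda>z. z) \<in> measurable ?D borel" using ident_lebesgue_borel by simp
  have "integrable M g \<longleftrightarrow> integrable (weight_measure w) (\<lambda>z. gauss z *\<^sub>R g z)"
    unfolding M_def by (rule integrable_density[OF gw]) simp
  also have "\<dots> \<longleftrightarrow> integrable ?D (\<lambda>z. gauss z *\<^sub>R g z)"
    unfolding weight_measure_def by (rule integrable_distr_eq[OF id]) measurable
  also have "\<dots> \<longleftrightarrow> integrable lebesgue (\<lambda>z. w z *\<^sub>R gauss z *\<^sub>R g z)"
    by (rule integrable_density[OF gl w_measurable]) (simp add: w_nonneg)
  finally show "integrable M g \<longleftrightarrow> integrable lebesgue (\<lambda>z. (gauss z * w z) *\<^sub>R g z)"
    by (simp add: mult.commute)
  have "(\<integral>z. g z \<partial>M) = (\<integral>z. gauss z *\<^sub>R g z \<partial>weight_measure w)"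
    unfolding M_def by (rule integral_density[OF gw]) simp
  also have "\<dots> = (\<integral>z. gauss z *\<^sub>R g z \<partial>?D)"
    unfolding weight_measure_def by (rule integral_distr[OF id]) measurable
  also have "\<dots> = (\<integral>z. w z *\<^sub>R gauss z *\<^sub>R g z \<partial>lebesgue)"
    by (rule integral_density[OF gl w_measurable]) (simp add: w_nonneg)
  finally show "(\<integral>z. g z \<partial>M) = (\<integral>z. (gauss z * w z) *\<^sub>R g z \<partial>lebesgue)"
    by (simp add: mult.commute)
qed

lemma fock_space_eq: "fock_space \<alpha> w = H"
proof -
  have "integrable lebesgue (\<lambda>z. (cmod (f z))\<^sup>2 * exp (- \<alpha> * (cmod z)\<^sup>2) * w z)
      \<longleftrightarrow> integrable M (\<lambda>z. (cmod (f z))\<^sup>2)" if "f holomorphic_on UNIV" for f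
  proof -
    have [measurable]: "f \<in> borel_measurable borel" by (rule entire_borel_measurable[OF that])
    show ?thesis by (subst integrable_M_iff) (auto simp: gauss_def mult_ac)
  qed
  then show ?thesis unfolding fock_space_def entire_L2_def by blast
qed

lemma fock_norm_eq: "f \<in> H \<Longrightarrow> fock_norm \<alpha> w f = sqrt (sqn f)"
  using H_meas[of f] unfolding fock_norm_def sqn_def
  by (subst integral_M) (auto simp: gauss_def mult_ac)

lemma fock_inner_eq: "f \<in> H \<Longrightarrow> g \<in> H \<Longrightarrow> fock_inner \<alpha> w f g = ip f g"
  using H_meas[of f] H_meas[of g] unfolding fock_inner_def ip_def
  by (subst integral_M) (auto simp: gauss_def mult_ac scaleR_conv_of_real)

lemma rep_kernel_eq: "rep_kernel \<alpha> w z = kernel z"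
proof -
  have "(g \<in> fock_space \<alpha> w \<and> (\<forall>f\<in>fock_space \<alpha> w. f z = fock_inner \<alpha> w f g))
      \<longleftrightarrow> (g \<in> H \<and> (\<forall>f\<in>H. f z = ip f g))" for g
    unfolding fock_space_eq using fock_inner_eq by auto
  then show ?thesis unfolding rep_kernel_def kernel_def by presburger
qed

lemma berezin_eq:
  "berezin \<alpha> w \<mu> z = (\<integral>\<^sup>+x. ennreal ((cmod (kernel z x / of_real (sqrt (sqn (kernel z)))))\<^sup>2 * gauss x) \<partial>\<mu>)"
  unfolding berezin_def normalized_kernel_def rep_kernel_eq fock_norm_eq[OF kernel_in_H] gauss_def ..

lemma average_function_eq:
  "average_function w r \<mu> z = emeasure \<mu> (ball z r) / emeasure (weight_measure w) (ball z r)"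
  unfolding average_function_def by (simp add: emeasure_weight_measure)

text \<open>The abstract Toeplitz operators contain no Gaussian; it is moved from the integrand into
  the measure.\<close>

lemma
  assumes \<mu>: "sets \<mu> = sets borel" and f: "f \<in> H"
  shows toeplitz_integrable_iff: "integrable \<mu> (toeplitz_integrand \<alpha> w f z)
      \<longleftrightarrow> integrable (density \<mu> (\<lambda>x. ennreal (gauss x))) (\<lambda>x. f x * cnj (kernel z x))"
    and toeplitz_eq: "toeplitz \<alpha> w \<mu> f z
      = (\<integral>x. f x * cnj (kernel z x) \<partial>density \<mu> (\<lambda>x. ennreal (gauss x)))"
proof -
  note [measurable] = H_meas[OF f] H_meas[OF kernel_in_H[of z]]
  have "(\<lambda>x. f x * cnj (kernel z x)) \<in> borel_measurable borel" by measurable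
  then have meas: "(\<lambda>x. f x * cnj (kernel z x)) \<in> borel_measurable \<mu>" "gauss \<in> borel_measurable \<mu>"
    using \<mu> gauss_measurable by (simp_all cong: measurable_cong_sets)
  have eq: "toeplitz_integrand \<alpha> w f z = (\<lambda>x. gauss x *\<^sub>R (f x * cnj (kernel z x)))"
    by (simp add: toeplitz_integrand_def[abs_def] rep_kernel_eq gauss_def scaleR_conv_of_real mult_ac)
  show "integrable \<mu> (toeplitz_integrand \<alpha> w f z)
      \<longleftrightarrow> integrable (density \<mu> (\<lambda>x. ennreal (gauss x))) (\<lambda>x. f x * cnj (kernel z x))"
    unfolding eq by (rule integrable_density[OF meas, symmetric]) simp
  show "toeplitz \<alpha> w \<mu> f z
      = (\<integral>x. f x * cnj (kernel z x) \<partial>density \<mu> (\<lambda>x. ennreal (gauss x)))"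
    unfolding toeplitz_def eq by (rule integral_density[OF meas, symmetric]) simp
qed

section \<open>The three inequalities between norm, Berezin transform and averages\<close>

lemma toeplitz_norm_finite_iff: "toeplitz_norm \<alpha> w \<mu> < \<infinity> \<longleftrightarrow> toeplitz_bounded \<alpha> w \<mu>"
proof
  assume "toeplitz_bounded \<alpha> w \<mu>"
  moreover then obtain C where
    C: "\<forall>f\<in>fock_space \<alpha> w. fock_norm \<alpha> w (toeplitz \<alpha> w \<mu> f) \<le> C * fock_norm \<alpha> w f"
    unfolding toeplitz_bounded_def by blast
  have "(SUP f\<in>{f \<in> fock_space \<alpha> w. fock_norm \<alpha> w f \<le> 1}.
      ennreal (fock_norm \<alpha> w (toeplitz \<alpha> w \<mu> f))) \<le> ennreal (max C 0)"
  proof (rule SUP_least)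
    fix f assume f: "f \<in> {f \<in> fock_space \<alpha> w. fock_norm \<alpha> w f \<le> 1}"
    have n: "0 \<le> fock_norm \<alpha> w f" by (simp add: fock_norm_def w_nonneg)
    have "fock_norm \<alpha> w (toeplitz \<alpha> w \<mu> f) \<le> C * fock_norm \<alpha> w f" using C f by blast
    also have "\<dots> \<le> max C 0 * fock_norm \<alpha> w f" using n by (intro mult_right_mono) auto
    also have "\<dots> \<le> max C 0 * 1" using f by (intro mult_left_mono) auto
    finally show "ennreal (fock_norm \<alpha> w (toeplitz \<alpha> w \<mu> f)) \<le> ennreal (max C 0)"
      by (intro ennreal_leI) simp
  qed
  ultimately show "toeplitz_norm \<alpha> w \<mu> < \<infinity>"
    unfolding toeplitz_norm_def using ennreal_less_top by (auto intro: le_less_trans)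
qed (auto simp: toeplitz_norm_def split: if_splits)

lemma berezin_le_norm:
  assumes \<mu>: "sets \<mu> = sets borel"
  shows "(SUP z. berezin \<alpha> w \<mu> z) \<le> toeplitz_norm \<alpha> w \<mu>"
proof (cases "toeplitz_bounded \<alpha> w \<mu>")
  case True
  show ?thesis
  proof (rule SUP_least)
    fix z
    note [measurable_cong] = \<mu>
    note [measurable] = H_meas[OF kernel_in_H[of z]]
    let ?N = "density \<mu> (\<lambda>x. ennreal (gauss x))"
    have eq: "toeplitz \<alpha> w \<mu> f = (\<lambda>z. \<integral>x. f x * cnj (kernel z x) \<partial>?N)" if "f \<in> H" for f
      using toeplitz_eq[OF \<mu> that] by blast
    have bounded: "(\<forall>z. integrable \<mu> (toeplitz_integrand \<alpha> w f z)) \<and> toeplitz \<alpha> w \<mu> f \<in> H"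
      if "f \<in> H" for f
      using True that unfolding toeplitz_bounded_def fock_space_eq by blast
    have "(\<integral>\<^sup>+x. ennreal ((cmod (kernel z x / of_real (sqrt (sqn (kernel z)))))\<^sup>2) \<partial>?N)
        \<le> toeplitz_norm \<alpha> w \<mu>"
    proof (rule berezin_le_toeplitz_norm)
      fix f assume f: "f \<in> H"
      show "integrable ?N (\<lambda>x. f x * cnj (kernel z x))" for z
        using bounded[OF f] toeplitz_integrable_iff[OF \<mu> f] by blast
      show T: "(\<lambda>z. \<integral>x. f x * cnj (kernel z x) \<partial>?N) \<in> H"
        using bounded[OF f] unfolding eq[OF f] by blast
      assume "sqn f \<le> 1"
      then have "f \<in> {f \<in> fock_space \<alpha> w. fock_norm \<alpha> w f \<le> 1}"
        using f by (simp add: fock_space_eq fock_norm_eq)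
      then have "ennreal (fock_norm \<alpha> w (toeplitz \<alpha> w \<mu> f)) \<le> toeplitz_norm \<alpha> w \<mu>"
        unfolding toeplitz_norm_def using True by (auto intro: SUP_upper)
      then show "ennreal (sqrt (sqn (\<lambda>z. \<integral>x. f x * cnj (kernel z x) \<partial>?N))) \<le> toeplitz_norm \<alpha> w \<mu>"
        unfolding eq[OF f] fock_norm_eq[OF T] .
    qed
    also have "(\<integral>\<^sup>+x. ennreal ((cmod (kernel z x / of_real (sqrt (sqn (kernel z)))))\<^sup>2) \<partial>?N)
        = berezin \<alpha> w \<mu> z"
      unfolding berezin_eq by (subst nn_integral_density) (auto simp: ennreal_mult mult.commute)
    finally show "berezin \<alpha> w \<mu> z \<le> toeplitz_norm \<alpha> w \<mu>" .
  qed
qed (simp add: toeplitz_norm_def)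

lemma average_le_SUP_berezin:
  obtains \<delta> where "0 < \<delta>" "\<And>r. 0 < r \<Longrightarrow> r < \<delta> \<Longrightarrow> \<exists>C>0. \<forall>\<mu>. sets \<mu> = sets borel \<longrightarrow>
    (SUP z. average_function w r \<mu> z) \<le> ennreal C * (SUP z. berezin \<alpha> w \<mu> z)"
proof -
  obtain \<delta> where \<delta>: "0 < \<delta>" "\<And>r. 0 < r \<Longrightarrow> r < \<delta> \<Longrightarrow> \<exists>C>0. \<forall>\<mu> z. sets \<mu> = sets borel \<longrightarrow>
      average_function w r \<mu> z \<le> ennreal C * berezin \<alpha> w \<mu> z"
    by (rule average_le_berezin) (rule that[unfolded average_function_eq berezin_eq])
  show ?thesis
  proof (rule that[OF \<delta>(1)])
    fix r :: real assume "0 < r" "r < \<delta>"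
    then obtain C where C: "0 < C" "\<And>\<mu> z. sets \<mu> = sets borel \<Longrightarrow>
        average_function w r \<mu> z \<le> ennreal C * berezin \<alpha> w \<mu> z"
      using \<delta>(2) by metis
    have "(SUP z. average_function w r \<mu> z) \<le> ennreal C * (SUP z. berezin \<alpha> w \<mu> z)"
      if "sets \<mu> = sets borel" for \<mu>
      by (rule SUP_least, rule order_trans[OF C(2)[OF that]]) (intro mult_left_mono SUP_upper, auto)
    then show "\<exists>C>0. \<forall>\<mu>. sets \<mu> = sets borel \<longrightarrow>
        (SUP z. average_function w r \<mu> z) \<le> ennreal C * (SUP z. berezin \<alpha> w \<mu> z)"
      using C(1) by blast
  qed
qed

lemma norm_le_SUP_average:
  assumes r: "0 < r" "r \<le> \<rho>"
  shows "\<exists>C>0. \<forall>\<mu>. sets \<mu> = sets borel \<longrightarrow>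
    toeplitz_norm \<alpha> w \<mu> \<le> ennreal C * (SUP z. average_function w r \<mu> z)"
proof -
  obtain C where C: "0 < C" "\<And>\<mu> A f. \<lbrakk>sets \<mu> = sets borel; 0 \<le> A;
       \<And>z. emeasure \<mu> (ball z r) \<le> ennreal A * emeasure (weight_measure w) (ball z r); f \<in> H\<rbrakk>
     \<Longrightarrow> (\<integral>\<^sup>+x. ennreal ((cmod (f x))\<^sup>2 * gauss x) \<partial>\<mu>) \<le> ennreal (C * A * sqn f)"
    by (rule Carleson_embedding[OF r]) (rule that, assumption, blast)
  have "toeplitz_norm \<alpha> w \<mu> \<le> ennreal C * (SUP z. average_function w r \<mu> z)"
    if \<mu>: "sets \<mu> = sets borel" for \<mu>
  proof (cases "SUP z. average_function w r \<mu> z")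
    \<comment> \<open>Positivity of \<open>C\<close> matters here, since
      \<open>0 * \<infinity> = 0\<close>.\<close>
    case top
    show ?thesis unfolding top using C(1) by (simp add: ennreal_mult_top)
  next
    case (real A)
    note [measurable_cong] = \<mu>
    let ?N = "density \<mu> (\<lambda>x. ennreal (gauss x))"
    have avg: "emeasure \<mu> (ball z r) \<le> ennreal A * emeasure (weight_measure w) (ball z r)" for z
    proof -
      have "emeasure (weight_measure w) (ball z r) \<noteq> 0"
        using ball_lower_V[OF r, of z] V_pos[of z] by auto
      moreover have "emeasure (weight_measure w) (ball z r) \<noteq> \<infinity>"
      proof -
        have "emeasure (weight_measure w) (ball z r) \<le> emeasure (weight_measure w) (ball z \<rho>)"
          using r by (intro emeasure_mono) auto
        then show ?thesis using finite_ball[of z] by (auto simp: top_unique)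
      qed
      ultimately have "emeasure \<mu> (ball z r) / emeasure (weight_measure w) (ball z r)
          * emeasure (weight_measure w) (ball z r) = emeasure \<mu> (ball z r)"
        by (simp add: ennreal_divide_times less_top[symmetric])
      moreover have "emeasure \<mu> (ball z r) / emeasure (weight_measure w) (ball z r) \<le> ennreal A"
        unfolding average_function_eq[symmetric] real(2)[symmetric] by (rule SUP_upper) simp
      ultimately show ?thesis
        by (metis mult_right_mono zero_le)
    qed
    have eq: "toeplitz \<alpha> w \<mu> f = (\<lambda>z. \<integral>x. f x * cnj (kernel z x) \<partial>?N)" if "f \<in> H" for f
      using toeplitz_eq[OF \<mu> that] by blast
    have Carleson: "(\<integral>\<^sup>+x. ennreal ((cmod (f x))\<^sup>2) \<partial>?N) \<le> ennreal (C * A * sqn f)" if "f \<in> H" for f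
    proof -
      note [measurable] = H_meas[OF that]
      have "(\<integral>\<^sup>+x. ennreal ((cmod (f x))\<^sup>2) \<partial>?N) = (\<integral>\<^sup>+x. ennreal ((cmod (f x))\<^sup>2 * gauss x) \<partial>\<mu>)"
        by (subst nn_integral_density) (auto simp: ennreal_mult mult.commute)
      then show ?thesis using C(2)[OF \<mu> real(1) avg that] by simp
    qed
    have N: "sets ?N = sets borel" using \<mu> by simp
    have CA: "0 \<le> C * A" using C(1) real(1) by simp
    have bound: "fock_norm \<alpha> w (toeplitz \<alpha> w \<mu> f) \<le> C * A * fock_norm \<alpha> w f" if "f \<in> H" for f
      using toeplitz_bounded_if_Carleson[OF N CA Carleson that] eq[OF that] fock_norm_eq[OF that]
      by (simp add: fock_norm_eq)
    have "integrable \<mu> (toeplitz_integrand \<alpha> w f z)" "toeplitz \<alpha> w \<mu> f \<in> H" if "f \<in> H" for f z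
      using toeplitz_bounded_if_Carleson[OF N CA Carleson that] eq[OF that]
      by (simp_all add: toeplitz_integrable_iff[OF \<mu> that])
    then have bounded: "toeplitz_bounded \<alpha> w \<mu>"
      unfolding toeplitz_bounded_def fock_space_eq using bound by blast
    have "(SUP f\<in>{f \<in> fock_space \<alpha> w. fock_norm \<alpha> w f \<le> 1}.
        ennreal (fock_norm \<alpha> w (toeplitz \<alpha> w \<mu> f))) \<le> ennreal (C * A)"
    proof (rule SUP_least)
      fix f assume f: "f \<in> {f \<in> fock_space \<alpha> w. fock_norm \<alpha> w f \<le> 1}"
      have "fock_norm \<alpha> w (toeplitz \<alpha> w \<mu> f) \<le> C * A * fock_norm \<alpha> w f"
        using f bound by (simp add: fock_space_eq)
      also have "\<dots> \<le> C * A * 1" using f CA by (intro mult_left_mono) auto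
      finally show "ennreal (fock_norm \<alpha> w (toeplitz \<alpha> w \<mu> f)) \<le> ennreal (C * A)"
        by (intro ennreal_leI) simp
    qed
    then show ?thesis
      using bounded real C(1) by (simp add: toeplitz_norm_def ennreal_mult')
  qed
  then show ?thesis using C(1) by blast
qed

end

theorem theorem1p1:
  fixes \<alpha> :: real and w :: "complex \<Rightarrow> real"
  assumes "0 < \<alpha>" and "w \<in> A_infty_restricted"
  shows "\<exists>\<delta>\<in>{0<..<1::real}.
    (\<forall>\<mu>\<in>positive_borel_measures.
       (toeplitz_bounded \<alpha> w \<mu> \<longleftrightarrow> bounded_on_plane (berezin \<alpha> w \<mu>)) \<and>
       (bounded_on_plane (berezin \<alpha> w \<mu>) \<longleftrightarrow>
          (\<exists>r\<in>{0<..<\<delta>}. bounded_on_plane (average_function w r \<mu>))) \<and>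
       ((\<exists>r\<in>{0<..<\<delta>}. bounded_on_plane (average_function w r \<mu>)) \<longleftrightarrow>
          (\<forall>r\<in>{0<..<\<delta>}. bounded_on_plane (average_function w r \<mu>)))) \<and>
    (\<forall>r\<in>{0<..<\<delta>}.
       comparable_on positive_borel_measures
         (\<lambda>\<mu>. toeplitz_norm \<alpha> w \<mu>) (\<lambda>\<mu>. SUP z. berezin \<alpha> w \<mu> z) \<and>
       comparable_on positive_borel_measures
         (\<lambda>\<mu>. SUP z. berezin \<alpha> w \<mu> z) (\<lambda>\<mu>. SUP z. average_function w r \<mu> z))"
proof -
  obtain \<rho> c m where "doubling_measure (weight_measure w) \<rho> c m"
    using A_infty_doubling_measure(2)[OF assms(2)] by blast
  then interpret doubling_measure "weight_measure w" \<rho> c m .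
  interpret weighted_fock_density w \<rho> c m \<alpha>
    by unfold_locales (use assms(1) A_infty_doubling_measure(1)[OF assms(2)] in auto)
  define P where "P = positive_borel_measures"
  have P: "sets \<mu> = sets borel" if "\<mu> \<in> P" for \<mu>
    using that by (simp add: P_def positive_borel_measures_def)
  define B where "B \<mu> = (SUP z. berezin \<alpha> w \<mu> z)" for \<mu>
  define S where "S r \<mu> = (SUP z. average_function w r \<mu> z)" for r \<mu>
  define T where "T \<mu> = toeplitz_norm \<alpha> w \<mu>" for \<mu>
  obtain \<delta>' where \<delta>': "0 < \<delta>'" "\<And>r. 0 < r \<Longrightarrow> r < \<delta>' \<Longrightarrow> \<exists>C>0. \<forall>\<mu>. sets \<mu> = sets borel \<longrightarrow>
      S r \<mu> \<le> ennreal C * B \<mu>"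
    by (rule average_le_SUP_berezin) (rule that[unfolded S_def B_def])
  \<comment> \<open>The bound 1/2 keeps \<delta> below 1, \<open>\<delta>'\<close> is the range for
    averages against the Berezin transform, and \<rho> the range for the Carleson embedding.\<close>
  define \<delta> where "\<delta> = min (1/2) (min \<delta>' \<rho>)"
  have BT: "B \<mu> \<le> T \<mu>" if "\<mu> \<in> P" for \<mu>
    unfolding B_def T_def by (rule berezin_le_norm[OF P[OF that]])
  have SB: "\<exists>C>0. \<forall>\<mu>\<in>P. S r \<mu> \<le> ennreal C * B \<mu>" if "r \<in> {0<..<\<delta>}" for r
    using \<delta>'(2)[of r] that P by (auto simp: \<delta>_def)
  have TS: "\<exists>C>0. \<forall>\<mu>\<in>P. T \<mu> \<le> ennreal C * S r \<mu>" if "r \<in> {0<..<\<delta>}" for r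
    using norm_le_SUP_average[of r] that P unfolding T_def S_def by (auto simp: \<delta>_def)
  have fin: "toeplitz_bounded \<alpha> w \<mu> \<longleftrightarrow> T \<mu> < \<infinity>" for \<mu>
    by (simp add: T_def toeplitz_norm_finite_iff del: infinity_ennreal_def)
  have le_fin: "x < \<infinity>" if "x \<le> ennreal C * y" "y < \<infinity>" for x y C
    using that by (auto intro: le_less_trans simp: ennreal_mult_less_top)
  have \<delta>: "\<delta> \<in> {0<..<1}" and half: "\<delta> / 2 \<in> {0<..<\<delta>}"
    using \<delta>'(1) \<rho>_pos by (auto simp: \<delta>_def)
  \<comment> \<open>Finiteness travels around the cycle of the three inequalities. The equivalence
    of \<open>T\<close> and \<open>B\<close> does not mention a radius, yet its proof passes through
    one; \<open>half\<close> supplies it.\<close>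
  have S_iff: "S r \<mu> < \<infinity> \<longleftrightarrow> B \<mu> < \<infinity>" and TB: "T \<mu> < \<infinity> \<longleftrightarrow> B \<mu> < \<infinity>"
    if "r \<in> {0<..<\<delta>}" "\<mu> \<in> P" for r \<mu>
    using SB[OF that(1)] TS[OF that(1)] BT[OF that(2)] that(2) le_fin le_less_trans by metis+
  have T_iff: "T \<mu> < \<infinity> \<longleftrightarrow> B \<mu> < \<infinity>" if "\<mu> \<in> P" for \<mu> by (rule TB[OF half that])
  have "comparable_on P T B \<and> comparable_on P B (S r)" if r: "r \<in> {0<..<\<delta>}" for r
  proof -
    obtain C1 where C1: "0 < C1" "\<And>\<mu>. \<mu> \<in> P \<Longrightarrow> S r \<mu> \<le> ennreal C1 * B \<mu>" using SB[OF r] by blast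
    obtain C2 where C2: "0 < C2" "\<And>\<mu>. \<mu> \<in> P \<Longrightarrow> T \<mu> \<le> ennreal C2 * S r \<mu>" using TS[OF r] by blast
    have "ennreal 1 * B \<mu> \<le> T \<mu>" "T \<mu> \<le> ennreal (C2 * C1) * B \<mu>" if "\<mu> \<in> P" for \<mu>
    proof -
      show "ennreal 1 * B \<mu> \<le> T \<mu>" using BT[OF that] by simp
      have "T \<mu> \<le> ennreal C2 * (ennreal C1 * B \<mu>)"
        by (rule order_trans[OF C2(2)[OF that] mult_left_mono[OF C1(2)[OF that]]]) simp
      then show "T \<mu> \<le> ennreal (C2 * C1) * B \<mu>" using C2(1) by (simp add: ennreal_mult' mult.assoc)
    qed
    moreover have "ennreal (1 / C1) * S r \<mu> \<le> B \<mu>" "B \<mu> \<le> ennreal C2 * S r \<mu>" if "\<mu> \<in> P" for \<mu>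
    proof -
      have "ennreal (1 / C1) * S r \<mu> \<le> ennreal (1 / C1) * (ennreal C1 * B \<mu>)"
        by (intro mult_left_mono C1(2) that) simp
      also have "\<dots> = ennreal (1 / C1 * C1) * B \<mu>"
        using C1(1) by (subst ennreal_mult') (auto simp: mult.assoc)
      finally show "ennreal (1 / C1) * S r \<mu> \<le> B \<mu>" using C1(1) by simp
      show "B \<mu> \<le> ennreal C2 * S r \<mu>" using BT[OF that] C2(2)[OF that] by (rule order_trans)
    qed
    moreover have "0 < C2 * C1" "0 < 1 / C1" using C1 C2 by auto
    ultimately show ?thesis
      unfolding comparable_on_def using C2(1) zero_less_one by metis
  qed
  then have comparable: "\<forall>r\<in>{0<..<\<delta>}. comparable_on P T B \<and> comparable_on P B (S r)" by blast
  have equiv: "\<forall>\<mu>\<in>P. (T \<mu> < \<infinity> \<longleftrightarrow> B \<mu> < \<infinity>) \<and>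
      (B \<mu> < \<infinity> \<longleftrightarrow> (\<exists>r\<in>{0<..<\<delta>}. S r \<mu> < \<infinity>)) \<and>
      ((\<exists>r\<in>{0<..<\<delta>}. S r \<mu> < \<infinity>) \<longleftrightarrow> (\<forall>r\<in>{0<..<\<delta>}. S r \<mu> < \<infinity>))"
    using S_iff T_iff half by blast
  show ?thesis
    using conjI[OF equiv comparable] \<delta>
    unfolding bounded_on_plane_def P_def[symmetric] B_def[symmetric] S_def[symmetric]
      T_def[symmetric] fin by (rule bexI)
qed

end
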